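(* Let $\mathcal{T}$ be an edge-to-edge spherical tiling by $F\ge 6$ congruent (possibly concave) quadrangles of type $t$, where $t\in\{2,4\}$, such that the map of $\mathcal{T}$ is the pseudo-double wheel $\mathrm{pdw}_F$ and every edge of length $b$ is non-meridian. Then the chart of $\mathcal{T}$, modulo mirror image, is necessarily $\mathcal{P}_F$.
   Context: Tilings are edge-to-edge tilings of the unit sphere, identified modulo $SO(3)$. Angles are measured in units of $\pi$ radians. Tile types. A spherical quadrangle has vertices with inner angles $\alpha,\beta,\gamma,\delta$ in this cyclic order. It is of type 4 if the edge joining the $\alpha$- and $\delta$-vertices has length $b$, the edge joining the $\delta$- and $\gamma$-vertices has length $c$, and the edges joining $\gamma,\beta$ and $\beta,\alpha$ both have length $a$, where $a,b,c$ are pairwise distinct. It is of type 2 if the same holds with $c=a\ne b$. For a type-2 quadrangle the labelings $(\alpha,\beta,\gamma,\delta)$ and $(\delta,\gamma,\beta,\alpha)$ describe the same tile; charts of type 2 are understood up to applying this relabeling simultaneously to all faces. Pseudo-double wheel. For even $F\ge6$, $\mathrm{pdw}_F$ is the spherical quadrangulation obtained from a cycle $v_0,\dots,v_{F-1}$ (indices mod $F$) by adding a vertex $N$ adjacent to every $v_{2i}$ and a vertex $S$ adjacent to every $v_{2i+1}$; its faces are $N v_{2i}v_{2i+1}v_{2i+2}$ and $S v_{2i-1}v_{2i}v_{2i+1}$, with the cyclic orders of this embedding. Edges incident to $N$ or $S$ are meridian, the others non-meridian. Charts. A chart consists of the map (graph with cyclic orders at vertices), an edge-length assignment, and an assignment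 of tile angles $\alpha,\beta,\gamma,\delta$ to the angles at vertices. The mirror image of a chart reverses all cyclic orders, keeping lengths, with angle $\angle uvw$ receiving the type of $\angle wvu$. The chart of $\mathcal{T}$ is $\mathcal{P}_F$ if the graph of $\mathcal{T}$ can be identified with $\mathrm{pdw}_F$ (preserving cyclic orders) so that lengths and angles agree with $\mathcal{P}_F$. The chart $\mathcal{P}_F$: map $\mathrm{pdw}_F$; each edge $v_{2i}v_{2i+1}$ has length $b$, each edge $v_{2i+1}v_{2i+2}$ has length $c$ (i.e. $a$ for type 2), each meridian edge has length $a$; in each face $N v_{2i}v_{2i+1}v_{2i+2}$ the angles at $N,v_{2i},v_{2i+1},v_{2i+2}$ are $\beta,\alpha,\delta,\gamma$, and in each face $S v_{2i-1}v_{2i}v_{2i+1}$ the angles at $S,v_{2i-1},v_{2i},v_{2i+1}$ are $\beta,\gamma,\delta,\alpha$. *)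

theory Defs
  imports "HOL-Analysis.Analysis"
begin

datatype pv = Nv | Sv | Vv nat

definition pdw_verts :: "nat \<Rightarrow> pv set" where
  "pdw_verts F = {Nv, Sv} \<union> Vv ` {..<F}"

text \<open>Faces, as vertex lists in the cyclic order of the embedding:
  N v_2i v_(2i+1) v_(2i+2) and S v_(2i-1) v_2i v_(2i+1), indices mod F.\<close>
definition NF :: "nat \<Rightarrow> nat \<Rightarrow> pv list" where
  "NF F i = [Nv, Vv (2*i), Vv (2*i+1), Vv ((2*i+2) mod F)]"

definition SF :: "nat \<Rightarrow> nat \<Rightarrow> pv list" where
  "SF F i = [Sv, Vv ((2*i+F-1) mod F), Vv (2*i), Vv (2*i+1)]"

definition pdw_faces :: "nat \<Rightarrow> pv list set" where
  "pdw_faces F = NF F ` {..<F div 2} \<union> SF F ` {..<F div 2}"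

definition pdw_meridian :: "nat \<Rightarrow> pv set set" where
  "pdw_meridian F = {{Nv, Vv (2*i)} | i. i < F div 2} \<union> {{Sv, Vv (2*i+1)} | i. i < F div 2}"

definition sdist :: "real^3 \<Rightarrow> real^3 \<Rightarrow> real" where
  "sdist p q = arccos (p \<bullet> q)"

text \<open>Great arc between two non-antipodal points of the unit sphere.\<close>
definition garc :: "real^3 \<Rightarrow> real^3 \<Rightarrow> (real^3) set" where
  "garc p q = (\<lambda>x. x /\<^sub>R norm x) ` closed_segment p q"

definition qbd :: "(real^3) list \<Rightarrow> (real^3) set" where
  "qbd ps = (\<Union>i<4. garc (ps!i) (ps!((i+1) mod 4)))"

definition sph_quadrangle :: "(real^3) set \<Rightarrow> (real^3) list \<Rightarrow> bool" where
  "sph_quadrangle R ps \<longleftrightarrow>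
     length ps = 4 \<and> distinct ps \<and> set ps \<subseteq> sphere 0 1 \<and>
     (\<forall>i<4. ps!i \<noteq> - (ps!((i+1) mod 4))) \<and>
     (\<forall>i<4. garc (ps!i) (ps!((i+1) mod 4)) \<inter> garc (ps!((i+1) mod 4)) (ps!((i+2) mod 4))
              = {ps!((i+1) mod 4)}) \<and>
     (\<forall>i<4. garc (ps!i) (ps!((i+1) mod 4)) \<inter> garc (ps!((i+2) mod 4)) (ps!((i+3) mod 4)) = {}) \<and>
     (\<exists>C \<in> components (sphere 0 1 - qbd ps). R = closure C)"

definition dihedral_eq :: "'a list \<Rightarrow> 'a list \<Rightarrow> bool" where
  "dihedral_eq xs ys \<longleftrightarrow> (\<exists>k. ys = rotate k xs \<or> ys = rotate k (rev xs))"

text \<open>pos gives the position of each vertex of pdw_F on the sphere, tile gives the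
  region of each face.  The tiles cover the sphere, overlap only along boundaries,
  and the tiling is edge-to-edge (a vertex lying on the boundary of a tile is a corner of it).\<close>
definition pdw_tiling :: "nat \<Rightarrow> (pv \<Rightarrow> real^3) \<Rightarrow> (pv list \<Rightarrow> (real^3) set) \<Rightarrow> bool" where
  "pdw_tiling F pos tile \<longleftrightarrow>
     inj_on pos (pdw_verts F) \<and> pos ` pdw_verts F \<subseteq> sphere 0 1 \<and>
     (\<forall>f \<in> pdw_faces F. sph_quadrangle (tile f) (map pos f)) \<and>
     \<Union>(tile ` pdw_faces F) = sphere 0 1 \<and>
     (\<forall>f \<in> pdw_faces F. \<forall>g \<in> pdw_faces F. f \<noteq> g \<longrightarrow> tile f \<inter> tile g \<subseteq> qbd (map pos f)) \<and>
     (\<forall>v \<in> pdw_verts F. \<forall>f \<in> pdw_faces F. pos v \<in> qbd (map pos f) \<longrightarrow> v \<in> set f)"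

definition congruent_tiling ::
  "nat \<Rightarrow> (pv \<Rightarrow> real^3) \<Rightarrow> (pv list \<Rightarrow> (real^3) set) \<Rightarrow> (real^3) set \<Rightarrow> (real^3) list \<Rightarrow> bool" where
  "congruent_tiling F pos tile Q qs \<longleftrightarrow>
     (\<forall>f \<in> pdw_faces F. \<exists>h. orthogonal_transformation h \<and> h ` Q = tile f \<and>
        dihedral_eq (map pos f) (map h qs))"

definition proto_type :: "nat \<Rightarrow> (real^3) set \<Rightarrow> real^3 \<Rightarrow> real^3 \<Rightarrow> real^3 \<Rightarrow> real^3 \<Rightarrow>
    real \<Rightarrow> real \<Rightarrow> real \<Rightarrow> bool" where
  "proto_type t Q A B C D a b c \<longleftrightarrow>
     sph_quadrangle Q [A, B, C, D] \<and>
     sdist A B = a \<and> sdist B C = a \<and> sdist C D = c \<and> sdist D A = b \<and>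
     ((t = 4 \<and> a \<noteq> b \<and> b \<noteq> c \<and> a \<noteq> c) \<or> (t = 2 \<and> c = a \<and> a \<noteq> b))"

text \<open>The chart of the tiling, read through the identification psi of pdw_F with the
  map of the tiling, is P_F: corner labels (via congruence with the prototile whose
  corners are named A',B',C',D') and edge lengths as in P_F.\<close>
definition chart_is_PF ::
  "nat \<Rightarrow> (pv \<Rightarrow> real^3) \<Rightarrow> (pv list \<Rightarrow> (real^3) set) \<Rightarrow> (pv \<Rightarrow> pv) \<Rightarrow> (real^3) set \<Rightarrow>
   real^3 \<Rightarrow> real^3 \<Rightarrow> real^3 \<Rightarrow> real^3 \<Rightarrow> real \<Rightarrow> real \<Rightarrow> real \<Rightarrow> bool" where
  "chart_is_PF F pos tile \<psi> Q A B C D a b c \<longleftrightarrow>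
     (\<forall>i < F div 2. \<forall>g \<in> pdw_faces F. set g = \<psi> ` set (NF F i) \<longrightarrow>
        (\<exists>h. orthogonal_transformation h \<and> h ` Q = tile g \<and>
             map h [B, A, D, C] = map (pos \<circ> \<psi>) (NF F i))) \<and>
     (\<forall>i < F div 2. \<forall>g \<in> pdw_faces F. set g = \<psi> ` set (SF F i) \<longrightarrow>
        (\<exists>h. orthogonal_transformation h \<and> h ` Q = tile g \<and>
             map h [B, C, D, A] = map (pos \<circ> \<psi>) (SF F i))) \<and>
     (\<forall>j < F. sdist (pos (\<psi> (Vv j))) (pos (\<psi> (Vv ((j+1) mod F)))) = (if even j then b else c)) \<and>
     (\<forall>i < F div 2. sdist (pos (\<psi> Nv)) (pos (\<psi> (Vv (2*i)))) = a \<and>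
                    sdist (pos (\<psi> Sv)) (pos (\<psi> (Vv (2*i+1)))) = a)"

end

theory Submission
  imports Defs
begin

text \<open>Every tile has exactly one edge of length \<open>b\<close>, and it lies on the cycle of the \<open>v\<^sub>j\<close>, so the
  \<open>b\<close>-edges alternate along the cycle; after a reflection they are the edges \<open>v\<^sub>2\<^sub>i v\<^sub>2\<^sub>i\<^sub>+\<^sub>1\<close>. What remains
  undetermined is which end of the \<open>b\<close>-edge of each tile is \<open>A\<close> and which is \<open>D\<close>. If \<open>a \<noteq> c\<close> the lengths of
  the meridian edges decide this. If \<open>a = c\<close> and \<open>AC = BD\<close>, the prototile has a symmetry exchanging
  \<open>A\<close> with \<open>D\<close> and \<open>B\<close> with \<open>C\<close> (a half-turn is excluded: it would exchange the prototile with its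
  complement, leaving room for two tiles only), so the choice is irrelevant.

  If \<open>a = c\<close> and \<open>AC \<noteq> BD\<close>, encode a corner with angle \<open>\<theta>\<close> by a complex number of argument \<open>\<theta>\<close>. Tiles lie
  on opposite sides of a common edge, so at every vertex of degree three the product of the
  three corner numbers is positive. If all tiles at a vertex agree this product is
  \<open>z\<^sub>A z\<^sub>D z\<^sub>B\<close> or \<open>z\<^sub>A z\<^sub>D z\<^sub>C\<close>, and both cannot occur as \<open>z\<^sub>B \<noteq> z\<^sub>C\<close> have the same modulus. If two tiles are
  mirror images in their common \<open>b\<close>-edge, then \<open>z\<^sub>A\<^sup>2 z\<^sub>X\<close> and \<open>z\<^sub>D\<^sup>2 z\<^sub>Y\<close> are positive for some
  \<open>X, Y \<in> {B, C}\<close>. For \<open>X \<noteq> Y\<close> this contradicts Coolsaet's identity for quadrangles with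
  three equal sides; for \<open>X = Y\<close> it gives \<open>z\<^sub>A = \<plusminus> z\<^sub>D\<close>, which is impossible because the angles at \<open>A\<close> and \<open>D\<close> are
  at most \<open>\<pi>\<close> (two concave corners on the two sides of an edge would overlap).\<close>

section \<open>Triple products and arcs on the sphere\<close>

text \<open>The sign tells on which side of the plane through 0, p and q the point x lies; left and
  right are always expressed by it.\<close>

definition tp :: "real^3 \<Rightarrow> real^3 \<Rightarrow> real^3 \<Rightarrow> real" where
  "tp p q x = cross3 p q \<bullet> x"

lemma tp_coords:
  "tp p q x = (p$2*q$3 - p$3*q$2) * x$1 + (p$3*q$1 - p$1*q$3) * x$2 + (p$1*q$2 - p$2*q$1) * x$3"
  by (simp add: tp_def cross3_simps)

lemma tp_cycle: "tp p q x = tp q x p"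
  by (simp add: tp_coords algebra_simps)

lemma tp_swap: "tp q p x = - tp p q x"
  by (simp add: tp_coords algebra_simps)

lemma tp_self [simp]: "tp p q p = 0" "tp p q q = 0" "tp p p q = 0"
  by (simp_all add: tp_coords algebra_simps)

lemma tp_linear:
  "tp p q (x + y) = tp p q x + tp p q y" "tp p q (r *\<^sub>R x) = r * tp p q x"
  "tp p q (x - y) = tp p q x - tp p q y" "tp p q (- x) = - tp p q x"
  by (simp_all add: tp_def inner_simps)

lemma tp_sgn: "tp p q (sgn x) = tp p q x / norm x"
  by (simp add: sgn_div_norm tp_linear divide_inverse mult.commute)

lemma continuous_tp: "continuous_on S (tp p q)"
  unfolding tp_def[abs_def] by (intro continuous_intros)

text \<open>The sign is the determinant of \<open>h\<close>, so an orthogonal map preserves all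
  sides or exchanges all of them.\<close>

lemma tp_orthogonal:
  assumes "orthogonal_transformation h"
  obtains e :: real where "e = 1 \<or> e = -1" "\<And>p q x. tp (h p) (h q) (h x) = e * tp p q x"
proof -
  let ?e = "det (matrix h)"
  have "?e = 1 \<or> ?e = -1"
    using assms by (auto simp: orthogonal_transformation_matrix det_orthogonal_matrix)
  moreover have "tp (h p) (h q) (h x) = ?e * tp p q x" for p q x
  proof -
    have "tp (h p) (h q) (h x) = (?e *\<^sub>R h (cross3 p q)) \<bullet> h x"
      using cross_orthogonal_transformation[OF assms] by (simp add: tp_def)
    then show ?thesis
      using assms by (simp add: tp_def orthogonal_transformation_def)
  qed
  ultimately show thesis by (rule that)
qed

lemma cross3_eq_0_unit:
  assumes "norm p = 1" "norm q = 1" "cross3 p q = 0"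
  shows "p = q \<or> p = - q"
proof -
  have "(norm (cross3 p q))\<^sup>2 + (p \<bullet> q)\<^sup>2 = 1"
    using norm_cross_dot[of p q] assms by simp
  then have "p \<bullet> q = 1 \<or> p \<bullet> q = -1"
    using assms by (simp add: power2_eq_1_iff)
  then have "(p - q) \<bullet> (p - q) = 0 \<or> (p + q) \<bullet> (p + q) = 0"
    using assms by (auto simp: inner_simps inner_commute norm_eq_1)
  then show ?thesis by (auto simp: add_eq_0_iff)
qed

text \<open>The slice is the radial projection of the cone \<open>?T\<close>, which is convex
  because for \<open>0 \<le> c\<close> the function \<open>x \<bullet> v - c * norm x\<close> is
  concave. With \<open>n = m\<close> this covers half caps, with two normals it covers
  sectors.\<close>

lemma connected_sphere_slice:
  fixes v n m :: "'a::real_inner"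
  assumes "0 \<le> c"
  shows "connected {x. norm x = 1 \<and> c < x \<bullet> v \<and> 0 < n \<bullet> x \<and> 0 < m \<bullet> x}" (is "connected ?S")
proof -
  let ?T = "{x. c * norm x < x \<bullet> v \<and> 0 < n \<bullet> x \<and> 0 < m \<bullet> x}"
  have "convex ?T"
  proof (rule convexI, clarify, intro conjI)
    fix x y and a b :: real
    assume *: "c * norm x < x \<bullet> v" "0 < n \<bullet> x" "0 < m \<bullet> x"
      "c * norm y < y \<bullet> v" "0 < n \<bullet> y" "0 < m \<bullet> y" "0 \<le> a" "0 \<le> b" "a + b = 1"
    have pos: "0 < a * r + b * t" if "0 < r" "0 < t" for r t :: real
      using * that by (cases "a = 0") (auto intro: add_pos_nonneg)
    have "norm (a *\<^sub>R x + b *\<^sub>R y) \<le> a * norm x + b * norm y"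
      using * norm_triangle_ineq[of "a *\<^sub>R x" "b *\<^sub>R y"] by simp
    then have "c * norm (a *\<^sub>R x + b *\<^sub>R y) \<le> c * (a * norm x + b * norm y)"
      using assms by (intro mult_left_mono)
    moreover have "0 < a * (x \<bullet> v - c * norm x) + b * (y \<bullet> v - c * norm y)"
      using * by (intro pos) auto
    ultimately show "c * norm (a *\<^sub>R x + b *\<^sub>R y) < (a *\<^sub>R x + b *\<^sub>R y) \<bullet> v"
      by (simp add: inner_simps algebra_simps)
    show "0 < n \<bullet> (a *\<^sub>R x + b *\<^sub>R y)" "0 < m \<bullet> (a *\<^sub>R x + b *\<^sub>R y)"
      using * by (auto simp: inner_simps intro!: pos)
  qed
  then have "connected ?T" by (rule convex_connected)
  moreover have "continuous_on ?T sgn"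
    by (intro continuous_on_sgn continuous_on_id) auto
  ultimately have "connected (sgn ` ?T)"
    by (rule connected_continuous_image[rotated])
  moreover have "sgn ` ?T = ?S"
  proof (intro equalityI subsetI)
    fix z assume "z \<in> sgn ` ?T"
    then obtain x where x: "z = sgn x" "c * norm x < x \<bullet> v" "0 < n \<bullet> x" "0 < m \<bullet> x" by auto
    then have "x \<noteq> 0" by auto
    then have "norm z = 1" using x by (simp add: norm_sgn)
    moreover have "r \<bullet> z = (r \<bullet> x) / norm x" for r
      using x by (simp add: sgn_div_norm divide_inverse mult.commute)
    moreover have "c < (v \<bullet> x) / norm x"
      using x \<open>x \<noteq> 0\<close> by (simp add: pos_less_divide_eq inner_commute)
    ultimately show "z \<in> ?S" using x \<open>x \<noteq> 0\<close> by (simp add: inner_commute)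
  next
    fix z assume "z \<in> ?S"
    then have "z \<in> ?T" "z = sgn z" by (auto simp: sgn_div_norm)
    then show "z \<in> sgn ` ?T" by (rule rev_image_eqI)
  qed
  ultimately show ?thesis by simp
qed

lemma sgn_approach:
  fixes y u :: "'a::real_inner"
  assumes "norm y = 1" "open U" "y \<in> U"
  obtains \<eta> where "0 < \<eta>" "norm (y + \<eta> *\<^sub>R u) > 0" "sgn (y + \<eta> *\<^sub>R u) \<in> U"
proof -
  have y0: "y \<noteq> 0" using assms by auto
  have "((\<lambda>\<eta>. y + \<eta> *\<^sub>R u) \<longlongrightarrow> y + 0 *\<^sub>R u) (at_right 0)"
    by (intro tendsto_intros)
  then have t: "((\<lambda>\<eta>. y + \<eta> *\<^sub>R u) \<longlongrightarrow> y) (at_right 0)" by simp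
  then have "((\<lambda>\<eta>. sgn (y + \<eta> *\<^sub>R u)) \<longlongrightarrow> sgn y) (at_right 0)"
    by (rule tendsto_sgn) (use y0 in auto)
  moreover have "sgn y = y" using assms by (simp add: sgn_div_norm)
  ultimately have "eventually (\<lambda>\<eta>. sgn (y + \<eta> *\<^sub>R u) \<in> U) (at_right 0)"
    using assms topological_tendstoD by metis
  moreover have "eventually (\<lambda>\<eta>. y + \<eta> *\<^sub>R u \<noteq> 0) (at_right 0)"
    using t y0 by (rule tendsto_imp_eventually_ne)
  moreover have "eventually (\<lambda>\<eta>::real. 0 < \<eta>) (at_right 0)"
    by (simp add: eventually_at_right_less)
  ultimately have "eventually (\<lambda>\<eta>. sgn (y + \<eta> *\<^sub>R u) \<in> U \<and> y + \<eta> *\<^sub>R u \<noteq> 0 \<and> 0 < \<eta>) (at_right 0)"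
    by eventually_elim auto
  then obtain \<eta> where "sgn (y + \<eta> *\<^sub>R u) \<in> U" "y + \<eta> *\<^sub>R u \<noteq> 0" "0 < \<eta>"
    using eventually_happens trivial_limit_at_right_real by (metis (mono_tags, lifting))
  then show thesis by (intro that) auto
qed

text \<open>On the unit sphere the squared distance is \<open>2 - 2 * (x \<bullet> y)\<close>, so
  caps are traces of balls.\<close>

lemma cap_avoiding_closed:
  fixes y :: "'a::real_inner"
  assumes "closed K" "y \<notin> K" "norm y = 1"
  obtains c where "0 \<le> c" "c < 1" "\<And>x. norm x = 1 \<Longrightarrow> c < x \<bullet> y \<Longrightarrow> x \<notin> K"
proof -
  obtain e where e: "0 < e" "ball y e \<subseteq> - K"
    using assms by (meson ComplI open_Compl open_contains_ball)
  show thesis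
  \<comment> \<open>The maximum with 0 provides the bound that \<open>connected_sphere_slice\<close>
    asks for.\<close>
  proof (rule that[of "max 0 (1 - e\<^sup>2/2)"])
    fix x assume x: "norm x = 1" "max 0 (1 - e\<^sup>2/2) < x \<bullet> y"
    have "(norm (x - y))\<^sup>2 = 2 - 2 * (x \<bullet> y)"
      using x assms by (simp add: power2_norm_eq_inner inner_simps inner_commute norm_eq_1)
    then have "(norm (x - y))\<^sup>2 < e\<^sup>2" using x by simp
    then have "norm (x - y) < e" using e power_less_imp_less_base by (metis less_eq_real_def)
    then have "x \<in> ball y e" by (simp add: dist_norm norm_minus_commute)
    then show "x \<notin> K" using e by blast
  qed (use e in auto)
qed

section \<open>Closed and open great arcs\<close>

definition oarc :: "real^3 \<Rightarrow> real^3 \<Rightarrow> (real^3) set" where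
  "oarc p q = {x. norm x = 1 \<and> (\<exists>r>0. \<exists>t>0. x = r *\<^sub>R p + t *\<^sub>R q)}"

lemma oarc_commute: "oarc p q = oarc q p"
  unfolding oarc_def by (subst add.commute) blast

lemma garc_iff:
  assumes "norm p = 1" "norm q = 1" "p \<noteq> - q"
  shows "x \<in> garc p q \<longleftrightarrow> norm x = 1 \<and> (\<exists>r\<ge>0. \<exists>t\<ge>0. x = r *\<^sub>R p + t *\<^sub>R q)"
proof
  assume "x \<in> garc p q"
  then obtain u where u: "0 \<le> u" "u \<le> 1" and x: "x = sgn ((1 - u) *\<^sub>R p + u *\<^sub>R q)"
    by (auto simp: garc_def closed_segment_def sgn_div_norm)
  have "(1 - u) *\<^sub>R p + u *\<^sub>R q \<noteq> 0"
  proof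
    assume 0: "(1 - u) *\<^sub>R p + u *\<^sub>R q = 0"
    then have "(1 - u) *\<^sub>R p = - (u *\<^sub>R q)" by (simp add: eq_neg_iff_add_eq_0)
    then have "norm ((1 - u) *\<^sub>R p) = norm (u *\<^sub>R q)" by simp
    then have "u = 1/2" using u assms by simp
    then have "(1/2) *\<^sub>R (p + q) = 0" using 0 by (simp only: scaleR_add_right) simp
    then show False using assms by (simp add: add_eq_0_iff2)
  qed
  then have "norm x = 1" using x by (simp add: norm_sgn)
  moreover have "x = ((1 - u) / norm ((1 - u) *\<^sub>R p + u *\<^sub>R q)) *\<^sub>R p
      + (u / norm ((1 - u) *\<^sub>R p + u *\<^sub>R q)) *\<^sub>R q"
    by (simp add: x sgn_div_norm scaleR_add_right divide_inverse mult.commute)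
  ultimately show "norm x = 1 \<and> (\<exists>r\<ge>0. \<exists>t\<ge>0. x = r *\<^sub>R p + t *\<^sub>R q)"
    using u by (metis diff_ge_0_iff_ge divide_nonneg_nonneg norm_ge_zero)
next
  assume "norm x = 1 \<and> (\<exists>r\<ge>0. \<exists>t\<ge>0. x = r *\<^sub>R p + t *\<^sub>R q)"
  then obtain r t where *: "norm x = 1" "0 \<le> r" "0 \<le> t" "x = r *\<^sub>R p + t *\<^sub>R q" by auto
  then have "r + t \<noteq> 0" by (metis add_nonneg_eq_0_iff norm_zero scale_zero_left zero_neq_one add_0)
  then have rt: "r + t > 0" using * by auto
  let ?u = "t / (r + t)"
  have "(1 - ?u) *\<^sub>R p + ?u *\<^sub>R q = (1 / (r + t)) *\<^sub>R x"
    using rt by (simp add: * scaleR_add_right field_simps)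
  then have "sgn ((1 - ?u) *\<^sub>R p + ?u *\<^sub>R q) = x"
    using rt * by (simp add: sgn_scaleR) (simp add: sgn_div_norm *)
  moreover have "(1 - ?u) *\<^sub>R p + ?u *\<^sub>R q \<in> closed_segment p q"
    using rt * by (auto simp: closed_segment_def intro!: exI[of _ ?u])
  ultimately show "x \<in> garc p q"
    unfolding garc_def by (metis (no_types, lifting) imageI sgn_div_norm)
qed

lemma garc_commute: "garc p q = garc q p"
  by (simp add: garc_def closed_segment_commute)

lemma closed_garc:
  assumes "norm p = 1" "norm q = 1" "p \<noteq> - q"
  shows "closed (garc p q)"
proof -
  have "0 \<notin> closed_segment p q"
  proof
    assume "0 \<in> closed_segment p q"
    then have "0 \<in> garc p q" by (force simp: garc_def)
    then show False using garc_iff[OF assms, of 0] by simp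
  qed
  then have "compact (garc p q)"
    unfolding garc_def
    by (intro compact_continuous_image continuous_intros) auto
  then show ?thesis by (rule compact_imp_closed)
qed

lemma garc_ends:
  assumes "norm p = 1" "norm q = 1" "p \<noteq> - q"
  shows "p \<in> garc p q" "q \<in> garc p q"
  unfolding garc_iff[OF assms]
   apply (metis add.right_neutral assms(1) scaleR_one scale_zero_left zero_le_one order_refl)
  by (metis add.left_neutral assms(2) scaleR_one scale_zero_left zero_le_one order_refl)

lemma oarc_subset_garc:
  assumes "norm p = 1" "norm q = 1" "p \<noteq> - q"
  shows "oarc p q \<subseteq> garc p q"
  using garc_iff[OF assms] unfolding oarc_def by (blast intro: less_imp_le)

lemma garc_subset_oarc:
  assumes "norm p = 1" "norm q = 1" "p \<noteq> - q"
  shows "garc p q \<subseteq> insert p (insert q (oarc p q))"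
proof
  fix x assume "x \<in> garc p q"
  then obtain r t where *: "norm x = 1" "0 \<le> r" "0 \<le> t" "x = r *\<^sub>R p + t *\<^sub>R q"
    using garc_iff[OF assms] by auto
  consider "r = 0" | "t = 0" | "r > 0" "t > 0" using * by linarith
  then show "x \<in> insert p (insert q (oarc p q))"
    by cases (use * assms in \<open>auto simp: oarc_def\<close>)
qed

lemma ends_notin_oarc:
  assumes "cross3 p q \<noteq> 0"
  shows "p \<notin> oarc p q" "q \<notin> oarc p q"
proof -
  have False if "t > 0" "p = r *\<^sub>R p + t *\<^sub>R q" for r t
  proof -
    have "cross3 p p = t *\<^sub>R cross3 p q"
      by (subst (2) that(2)) (simp add: cross_add_right cross_mult_right)
    then show False using assms that by simp
  qed
  then show "p \<notin> oarc p q" by (auto simp: oarc_def)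
  have False if "r > 0" "q = r *\<^sub>R p + t *\<^sub>R q" for r t
  proof -
    have "cross3 q q = r *\<^sub>R cross3 q p"
      by (subst (2) that(2)) (simp add: cross_add_right cross_mult_right)
    then show False using assms that cross_skew[of q p] by simp
  qed
  then show "q \<notin> oarc p q" by (auto simp: oarc_def)
qed

lemma tp_oarc: "y \<in> oarc p q \<Longrightarrow> tp p q y = 0"
  by (auto simp: oarc_def tp_linear)

lemma tp_garc: "x \<in> garc p q \<Longrightarrow> tp p q x = 0"
  by (auto simp: garc_def closed_segment_def tp_linear)

lemma oarc_nonempty:
  assumes "norm p = 1" "norm q = 1" "p \<noteq> - q"
  obtains y where "y \<in> oarc p q"
proof -
  have "p + q \<noteq> 0" using assms by (simp add: add_eq_0_iff2)
  then have "sgn (p + q) \<in> oarc p q"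
    using norm_sgn[of "p + q"] unfolding oarc_def mem_Collect_eq
    by (intro conjI exI[of _ "inverse (norm (p + q))"])
      (auto simp: sgn_div_norm scaleR_add_right)
  then show thesis by (rule that)
qed

lemma oarc_near_end:
  assumes "norm p = 1" "norm v = 1" "open U" "v \<in> U"
  obtains y where "y \<in> oarc p v" "y \<in> U"
proof -
  obtain \<eta> where *: "0 < \<eta>" "norm (v + \<eta> *\<^sub>R p) > 0" "sgn (v + \<eta> *\<^sub>R p) \<in> U"
    using sgn_approach[of v U p] assms by metis
  let ?n = "norm (v + \<eta> *\<^sub>R p)"
  have "sgn (v + \<eta> *\<^sub>R p) = (\<eta> / ?n) *\<^sub>R p + (1 / ?n) *\<^sub>R v"
    by (simp add: sgn_div_norm scaleR_add_right divide_inverse mult.commute)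
  moreover have "norm (sgn (v + \<eta> *\<^sub>R p)) = 1" using * by (auto simp: norm_sgn)
  ultimately have "sgn (v + \<eta> *\<^sub>R p) \<in> oarc p v"
    unfolding oarc_def using * by (smt (verit) divide_pos_pos mem_Collect_eq)
  then show thesis using * by (intro that)
qed

text \<open>The open arc is the image of the open quadrant of coefficient pairs under
  normalisation.\<close>

lemma connected_oarc:
  assumes "cross3 p q \<noteq> 0"
  shows "connected (oarc p q)"
proof -
  let ?f = "\<lambda>z::real \<times> real. fst z *\<^sub>R p + snd z *\<^sub>R q" and ?D = "{0::real<..} \<times> {0::real<..}"
  have nz: "?f z \<noteq> 0" if "z \<in> ?D" for z
  proof
    assume "?f z = 0"
    then have "cross3 p (?f z) = 0" by simp
    then have "snd z *\<^sub>R cross3 p q = 0" by (simp add: cross_add_right cross_mult_right)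
    then show False using assms that by auto
  qed
  have "connected ?D" by (intro connected_Times) auto
  moreover have "continuous_on ?D (\<lambda>z. sgn (?f z))"
    using nz by (intro continuous_on_sgn continuous_intros) auto
  ultimately have "connected ((\<lambda>z. sgn (?f z)) ` ?D)"
    by (rule connected_continuous_image[rotated])
  moreover have "(\<lambda>z. sgn (?f z)) ` ?D = oarc p q"
  proof (intro equalityI subsetI)
    fix x assume "x \<in> (\<lambda>z. sgn (?f z)) ` ?D"
    then obtain z where z: "z \<in> ?D" "x = sgn (?f z)" by auto
    let ?n = "norm (?f z)"
    have "?n > 0" "norm x = 1" using nz[OF z(1)] z by (auto simp: norm_sgn)
    moreover have "x = (fst z / ?n) *\<^sub>R p + (snd z / ?n) *\<^sub>R q"
      by (simp add: z sgn_div_norm scaleR_add_right divide_inverse mult.commute)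
    ultimately show "x \<in> oarc p q"
      unfolding oarc_def mem_Collect_eq using z by (intro conjI exI[of _ "fst z / ?n"] exI[of _ "snd z / ?n"]) auto
  next
    fix x assume "x \<in> oarc p q"
    then obtain r t where "norm x = 1" "r > 0" "t > 0" "x = r *\<^sub>R p + t *\<^sub>R q"
      by (auto simp: oarc_def)
    then have "x = sgn (?f (r, t))" "(r, t) \<in> ?D" by (auto simp: sgn_div_norm)
    then show "x \<in> (\<lambda>z. sgn (?f z)) ` ?D" by (rule rev_image_eqI[rotated])
  qed
  ultimately show ?thesis by simp
qed

lemma component_dichotomy:
  assumes "C \<in> components X" "connected S" "S \<subseteq> X"
  shows "S \<subseteq> C \<or> S \<inter> C = {}"
  using assms components_maximal by blast

section \<open>One-sided germs of a region along an arc and at a corner\<close>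

definition half_cap :: "real \<Rightarrow> real^3 \<Rightarrow> real^3 \<Rightarrow> real^3 \<Rightarrow> real \<Rightarrow> (real^3) set" where
  "half_cap s p q y c = {x. norm x = 1 \<and> c < x \<bullet> y \<and> 0 < s * tp p q x}"

text \<open>A germ condition: close to \<open>y\<close>, the whole \<open>s\<close>-side of the
  great circle belongs to \<open>C\<close>.\<close>

definition edge_at :: "real \<Rightarrow> (real^3) set \<Rightarrow> real^3 \<Rightarrow> real^3 \<Rightarrow> real^3 \<Rightarrow> bool" where
  "edge_at s C p q y \<longleftrightarrow> (\<exists>c<1. half_cap s p q y c \<subseteq> C)"

text \<open>One point of the arc suffices, as \<open>edge_at_const\<close> makes its choice
  immaterial for the regions considered.\<close>

definition side :: "real \<Rightarrow> (real^3) set \<Rightarrow> real^3 \<Rightarrow> real^3 \<Rightarrow> bool" where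
  "side s C p q \<longleftrightarrow> (\<exists>y \<in> oarc p q. edge_at s C p q y)"

text \<open>Near \<open>v\<close> the sector is the region on the \<open>s\<close>-side (\<open>s = 1\<close>: left) of the path \<open>p, v, q\<close>; the two cases are
  an angle below \<open>\<pi>\<close> and an angle of at least \<open>\<pi>\<close>.\<close>
definition sector :: "real \<Rightarrow> real^3 \<Rightarrow> real^3 \<Rightarrow> real^3 \<Rightarrow> (real^3) set" where
  "sector s p v q =
    (if 0 < s * tp p v q then {x. 0 < s * tp p v x \<and> 0 < s * tp v q x}
     else {x. 0 < s * tp p v x \<or> 0 < s * tp v q x})"

definition corner_cap :: "real \<Rightarrow> real^3 \<Rightarrow> real^3 \<Rightarrow> real^3 \<Rightarrow> real \<Rightarrow> (real^3) set" where
  "corner_cap s p v q c = {x. norm x = 1 \<and> c < x \<bullet> v \<and> x \<in> sector s p v q}"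

definition corner_at :: "real \<Rightarrow> (real^3) set \<Rightarrow> real^3 \<Rightarrow> real^3 \<Rightarrow> real^3 \<Rightarrow> bool" where
  "corner_at s C p v q \<longleftrightarrow> (\<exists>c<1. corner_cap s p v q c \<subseteq> C)"

lemma half_cap_reverse: "half_cap (- s) q p y c = half_cap s p q y c"
  by (simp add: half_cap_def tp_swap[of q p])

lemma side_reverse: "side (- s) C q p = side s C p q"
  by (simp add: side_def edge_at_def half_cap_reverse oarc_commute[of q p])

lemma sector_reverse: "sector (- s) q v p = sector s p v q"
proof -
  have "tp q v p = - tp p v q" by (simp add: tp_coords algebra_simps)
  then show ?thesis
    by (auto simp: sector_def tp_swap[of q v] tp_swap[of v p])
qed

lemma corner_at_reverse: "corner_at (- s) C q v p = corner_at s C p v q"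
  by (simp add: corner_at_def corner_cap_def sector_reverse)

lemma connected_half_cap:
  assumes "0 \<le> c"
  shows "connected (half_cap s p q y c)"
proof -
  have "half_cap s p q y c = {x. norm x = 1 \<and> c < x \<bullet> y \<and> 0 < (s *\<^sub>R cross3 p q) \<bullet> x \<and> 0 < (s *\<^sub>R cross3 p q) \<bullet> x}"
    by (auto simp: half_cap_def tp_def)
  then show ?thesis by (simp only: connected_sphere_slice[OF assms])
qed

lemma half_side_approach:
  assumes "norm y = 1" "tp p q y = 0" "cross3 p q \<noteq> 0" "s \<noteq> 0" "open U" "y \<in> U"
  obtains x where "x \<in> U" "norm x = 1" "0 < s * tp p q x"
proof -
  let ?u = "s *\<^sub>R cross3 p q"
  obtain \<eta> where *: "0 < \<eta>" "norm (y + \<eta> *\<^sub>R ?u) > 0" "sgn (y + \<eta> *\<^sub>R ?u) \<in> U"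
    using sgn_approach[of y U ?u] assms by metis
  have "s * tp p q (sgn (y + \<eta> *\<^sub>R ?u)) = s * s * \<eta> * (cross3 p q \<bullet> cross3 p q) / norm (y + \<eta> *\<^sub>R ?u)"
    unfolding tp_sgn tp_linear using assms by (simp add: tp_def)
  also have "\<dots> > 0"
  proof -
    have "0 < s * s" using assms by (simp add: zero_less_mult_iff) linarith
    moreover have "0 < \<eta> * (cross3 p q \<bullet> cross3 p q) / norm (y + \<eta> *\<^sub>R ?u)"
      using assms * by (intro divide_pos_pos mult_pos_pos) auto
    ultimately have "0 < (s * s) * (\<eta> * (cross3 p q \<bullet> cross3 p q) / norm (y + \<eta> *\<^sub>R ?u))"
      by (rule mult_pos_pos)
    then show ?thesis by (simp only: mult.assoc times_divide_eq_right)
  qed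
  finally show thesis
    using * by (intro that[of "sgn (y + \<eta> *\<^sub>R ?u)"]) (auto simp: norm_sgn)
qed

lemma open_cap: "open {x::'a::real_inner. c < x \<bullet> y}"
  by (intro open_Collect_less continuous_intros)

lemma open_tp_pos: "open {x. 0 < s * tp p q x}"
  unfolding tp_def by (intro open_Collect_less continuous_intros)

text \<open>Every neighbourhood of the point \<open>b\<close> of the great circle contains points
  strictly on the \<open>s\<close>-side. This makes germs at nearby points comparable.\<close>

lemma half_caps_meet:
  assumes "norm b = 1" "tp p q b = 0" "cross3 p q \<noteq> 0" "s \<noteq> 0" "c < b \<bullet> a" "c' < 1"
  obtains x where "x \<in> half_cap s p q a c" "x \<in> half_cap s p q b c'"
proof -
  have "b \<in> {x. c < x \<bullet> a} \<inter> {x. c' < x \<bullet> b}"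
    using assms by (simp add: norm_eq_1)
  moreover have "open ({x. c < x \<bullet> a} \<inter> {x. c' < x \<bullet> b})"
    by (intro open_Int open_cap)
  ultimately obtain x where "x \<in> {x. c < x \<bullet> a} \<inter> {x. c' < x \<bullet> b}" "norm x = 1" "0 < s * tp p q x"
    using half_side_approach assms by metis
  then show thesis by (intro that) (auto simp: half_cap_def)
qed

text \<open>The half cap misses the great circle, hence the arc, and for \<open>c\<close> near 1
  also \<open>K\<close>; being connected, it lies inside a component or outside.\<close>

lemma edge_dichotomy:
  assumes "norm p = 1" "norm q = 1" "p \<noteq> - q" "closed K" "oarc p q \<inter> K = {}"
    and "C \<in> components (sphere 0 1 - (garc p q \<union> K))" "y \<in> oarc p q"
  obtains c where "0 \<le> c" "c < 1" "half_cap s p q y c \<subseteq> C \<or> half_cap s p q y c \<inter> C = {}"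
proof -
  have "y \<notin> K" "norm y = 1" using assms by (auto simp: oarc_def)
  then obtain c where c: "0 \<le> c" "c < 1" "\<And>x. norm x = 1 \<Longrightarrow> c < x \<bullet> y \<Longrightarrow> x \<notin> K"
    using cap_avoiding_closed[OF \<open>closed K\<close>] by metis
  have "half_cap s p q y c \<subseteq> sphere 0 1 - (garc p q \<union> K)"
    using c tp_garc by (force simp: half_cap_def)
  then show thesis
    using component_dichotomy[OF assms(6) connected_half_cap] c that by metis
qed

text \<open>The truth value is locally constant, since half caps at nearby points overlap and each
  lies in \<open>C\<close> or outside as a whole; and the open arc is connected.\<close>

lemma edge_at_const:
  assumes "norm p = 1" "norm q = 1" "p \<noteq> - q" "cross3 p q \<noteq> 0" "closed K" "oarc p q \<inter> K = {}"
    and "C \<in> components (sphere 0 1 - (garc p q \<union> K))" "y \<in> oarc p q" "z \<in> oarc p q" "s \<noteq> 0"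
  shows "edge_at s C p q y = edge_at s C p q z"
proof (rule connected_local_const[OF connected_oarc[OF assms(4)] assms(8,9)], rule ballI)
  fix a assume a: "a \<in> oarc p q"
  then have "norm a = 1" by (auto simp: oarc_def)
  obtain c where c: "0 \<le> c" "c < 1" "half_cap s p q a c \<subseteq> C \<or> half_cap s p q a c \<inter> C = {}"
    using edge_dichotomy assms a by metis
  have main: "edge_at s C p q b \<longleftrightarrow> half_cap s p q a c \<subseteq> C" if b: "b \<in> oarc p q" "c < b \<bullet> a" for b
  proof
    have nb: "norm b = 1" "tp p q b = 0" using b tp_oarc by (auto simp: oarc_def)
    {
      assume "edge_at s C p q b"
      then obtain d where d: "d < 1" "half_cap s p q b d \<subseteq> C" by (auto simp: edge_at_def)
      then obtain x where "x \<in> half_cap s p q a c" "x \<in> half_cap s p q b d"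
        using half_caps_meet[OF nb assms(4,10) b(2)] by metis
      then show "half_cap s p q a c \<subseteq> C" using c d by blast
    next
      assume *: "half_cap s p q a c \<subseteq> C"
      obtain d where d: "0 \<le> d" "d < 1" "half_cap s p q b d \<subseteq> C \<or> half_cap s p q b d \<inter> C = {}"
        using edge_dichotomy assms b by metis
      then obtain x where "x \<in> half_cap s p q a c" "x \<in> half_cap s p q b d"
        using half_caps_meet[OF nb assms(4,10) b(2)] by metis
      then show "edge_at s C p q b" using d * by (auto simp: edge_at_def)
    }
  qed
  have "c < a \<bullet> a" using c \<open>norm a = 1\<close> by (simp add: norm_eq_1)
  then have "eventually (\<lambda>b. b \<in> {b. c < b \<bullet> a}) (at a within oarc p q)"
    using open_cap[of c a] by (intro eventually_at_topological[THEN iffD2]) auto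
  moreover have "eventually (\<lambda>b. b \<in> oarc p q) (at a within oarc p q)"
    by (auto simp: eventually_at_filter)
  ultimately show "\<forall>\<^sub>F b in at a within oarc p q. edge_at s C p q a = edge_at s C p q b"
    by eventually_elim (use main a \<open>c < a \<bullet> a\<close> in auto)
qed

text \<open>Equality in Cauchy-Schwarz means a zero angle: both arcs leave \<open>v\<close> in the
  same direction, so one contains the far end of the other, although they meet in \<open>v\<close>
  only.\<close>

lemma wedge_nondegenerate:
  assumes "norm p = 1" "norm v = 1" "norm q = 1" "p \<noteq> - v" "v \<noteq> - q"
    and "cross3 p v \<noteq> 0" "cross3 v q \<noteq> 0" "garc p v \<inter> garc v q = {v}"
  shows "cross3 p v \<bullet> cross3 q v \<noteq> norm (cross3 p v) * norm (cross3 q v)"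
proof
  assume "cross3 p v \<bullet> cross3 q v = norm (cross3 p v) * norm (cross3 q v)"
  then have *: "norm (cross3 p v) *\<^sub>R cross3 q v = norm (cross3 q v) *\<^sub>R cross3 p v"
    by (simp add: norm_cauchy_schwarz_eq)
  define a b where "a = norm (cross3 p v)" and "b = norm (cross3 q v)"
  have pos: "a > 0" "b > 0" using assms cross_skew[of q v] by (auto simp: a_def b_def)
  define w where "w = a *\<^sub>R q - b *\<^sub>R p"
  define \<kappa> where "\<kappa> = w \<bullet> v"
  have "cross3 w v = 0"
    using * by (simp add: w_def a_def b_def Cross3.left_diff_distrib cross_mult_left)
  have "w = \<kappa> *\<^sub>R v"
  proof -
    have "(norm (w - \<kappa> *\<^sub>R v))\<^sup>2 = (norm w)\<^sup>2 - \<kappa>\<^sup>2"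
      using \<open>norm v = 1\<close> by (simp add: power2_norm_eq_inner inner_simps inner_commute \<kappa>_def norm_eq_1)
        (simp add: power2_eq_square)
    also have "\<dots> = 0"
      using norm_cross_dot[of w v] \<open>norm v = 1\<close> \<open>cross3 w v = 0\<close> by (simp add: \<kappa>_def)
    finally show ?thesis by simp
  qed
  then have aq: "a *\<^sub>R q = b *\<^sub>R p + \<kappa> *\<^sub>R v" by (simp add: w_def algebra_simps)
  show False
  \<comment> \<open>The sign of \<open>\<kappa>\<close> decides which of the two arcs contains the
    end of the other.\<close>
  proof (cases "0 \<le> \<kappa>")
    case True
    have "q = (b / a) *\<^sub>R p + (\<kappa> / a) *\<^sub>R v"
      using aq pos by (metis (no_types, opaque_lifting) divide_inverse_commute left_inverse less_numeral_extra(3) scaleR_add_right scaleR_one scaleR_scaleR)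
    then have "q \<in> garc p v"
      using garc_iff[of p v q] assms pos True by (metis divide_nonneg_pos less_imp_le)
    then have "q = v" using assms garc_ends[of v q] by blast
    then show False using assms by simp
  next
    case False
    have "b *\<^sub>R p = (-\<kappa>) *\<^sub>R v + a *\<^sub>R q" using aq by simp
    then have "p = (-\<kappa> / b) *\<^sub>R v + (a / b) *\<^sub>R q"
      using pos by (metis (no_types, opaque_lifting) divide_inverse_commute left_inverse less_numeral_extra(3) scaleR_add_right scaleR_one scaleR_scaleR)
    moreover have "-\<kappa> / b \<ge> 0" "a / b \<ge> 0" using False pos by (auto simp: field_simps)
    ultimately have "p \<in> garc v q"
      using garc_iff[of v q p] assms by blast
    then have "p = v" using assms garc_ends[of p v] by blast
    then show False using assms by simp
  qed
qed

section \<open>Corner numbers\<close>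

text \<open>The argument is the angle at \<open>v\<close> of the region on the \<open>s\<close>-side of the path \<open>p, v, q\<close>, and the modulus
  is \<open>sin \<bar>pv\<bar> sin \<bar>qv\<bar>\<close>.\<close>
definition corner_number :: "real \<Rightarrow> real^3 \<Rightarrow> real^3 \<Rightarrow> real^3 \<Rightarrow> complex" where
  "corner_number s p v q = Complex (p \<bullet> q - (p \<bullet> v) * (q \<bullet> v)) (s * tp p v q)"

lemma corner_number_reverse: "corner_number (- s) q v p = corner_number s p v q"
  by (simp add: corner_number_def tp_coords inner_commute algebra_simps)

text \<open>A rotation carries the third axis to \<open>v\<close>; the images of the other two axes
  are coordinates of the tangent plane at \<open>v\<close>.\<close>

lemma orthonormal_frame:
  fixes v :: "real^3"
  assumes "norm v = 1"
  obtains e f :: "real^3" where "\<And>x y. x \<bullet> y = (x \<bullet> e) * (y \<bullet> e) + (x \<bullet> f) * (y \<bullet> f) + (x \<bullet> v) * (y \<bullet> v)"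
    "\<And>x y. tp x v y = (x \<bullet> f) * (y \<bullet> e) - (x \<bullet> e) * (y \<bullet> f)"
proof -
  obtain h :: "real^3 \<Rightarrow> real^3" where h: "orthogonal_transformation h" "det (matrix h) = 1" "h (axis 3 1) = v"
    by (rule rotation_exists_1[of "axis 3 1" v]) (use assms in \<open>auto simp: norm_axis_1\<close>)
  have ip: "h x \<bullet> h y = x \<bullet> y" for x y using h by (simp add: orthogonal_transformation_def)
  have surj: "\<exists>x'. x = h x'" for x using orthogonal_transformation_surj[OF h(1)] by (rule surjD)
  show thesis
  proof (rule that[of "h (axis 1 1)" "h (axis 2 1)"])
    fix x y :: "real^3"
    obtain x' y' where [simp]: "x = h x'" "y = h y'" using surj by metis
    show "x \<bullet> y = (x \<bullet> h (axis 1 1)) * (y \<bullet> h (axis 1 1)) + (x \<bullet> h (axis 2 1)) * (y \<bullet> h (axis 2 1)) + (x \<bullet> v) * (y \<bullet> v)"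
      by (simp add: ip h(3)[symmetric] inner_axis) (simp add: inner_vec_def sum_3)
    have "tp x v y = h (cross3 x' (axis 3 1)) \<bullet> h y'"
      using cross_orthogonal_transformation[OF h(1), of x' "axis 3 1"] h by (simp add: tp_def)
    also have "\<dots> = tp x' (axis 3 1) y'" by (simp add: ip tp_def)
    finally show "tp x v y = (x \<bullet> h (axis 2 1)) * (y \<bullet> h (axis 1 1)) - (x \<bullet> h (axis 1 1)) * (y \<bullet> h (axis 2 1))"
      by (simp add: ip inner_axis tp_coords) (simp add: axis_def)
  qed
qed

text \<open>Projection along \<open>v\<close> turns points into complex numbers of the tangent
  plane, conjugated if \<open>s = -1\<close>. In this form products of corner numbers around
  \<open>v\<close> telescope.\<close>

lemma corner_number_factors:
  assumes "norm v = 1" "s = 1 \<or> s = -1"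
  obtains Z where "\<And>x y. corner_number s x v y = Z x * cnj (Z y)" "\<And>x. cmod (Z x) = norm (cross3 x v)"
proof -
  obtain e f :: "real^3" where ip: "\<And>x y. x \<bullet> y = (x \<bullet> e) * (y \<bullet> e) + (x \<bullet> f) * (y \<bullet> f) + (x \<bullet> v) * (y \<bullet> v)"
    and t: "\<And>x y. tp x v y = (x \<bullet> f) * (y \<bullet> e) - (x \<bullet> e) * (y \<bullet> f)"
    using orthonormal_frame[OF assms(1)] by blast
  define Z where "Z x = Complex (x \<bullet> e) (s * (x \<bullet> f))" for x
  show thesis
  proof (rule that[of Z])
    fix x y
    have "x \<bullet> y - (x \<bullet> v) * (y \<bullet> v) = (x \<bullet> e) * (y \<bullet> e) + (x \<bullet> f) * (y \<bullet> f)"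
      by (subst ip) simp
    then show "corner_number s x v y = Z x * cnj (Z y)"
      using assms(2) by (auto simp: corner_number_def t Z_def complex_eq_iff)
    have "(norm (cross3 x v))\<^sup>2 = x \<bullet> x - (x \<bullet> v) * (x \<bullet> v)"
      using norm_cross_dot[of x v] assms(1) by (simp add: power_mult_distrib power2_norm_eq_inner power2_eq_square[of "x \<bullet> v"])
    also have "\<dots> = (x \<bullet> e)\<^sup>2 + (x \<bullet> f)\<^sup>2"
      by (subst ip) (simp add: power2_eq_square)
    also have "\<dots> = (cmod (Z x))\<^sup>2"
      using assms(2) by (auto simp: Z_def cmod_power2)
    finally show "cmod (Z x) = norm (cross3 x v)" by simp
  qed
qed

text \<open>Each projected neighbour occurs once plain and once conjugated: the three angles around
  \<open>v\<close> sum to a multiple of \<open>2 * pi\<close>.\<close>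

lemma corner_number_product:
  assumes "norm v = 1" "s = 1 \<or> s = -1"
  shows "corner_number s a v b * corner_number s b v c * corner_number s c v a =
    of_real ((norm (cross3 a v))\<^sup>2 * (norm (cross3 b v))\<^sup>2 * (norm (cross3 c v))\<^sup>2)"
proof -
  obtain Z where Z: "\<And>x y. corner_number s x v y = Z x * cnj (Z y)" "\<And>x. cmod (Z x) = norm (cross3 x v)"
    using corner_number_factors[OF assms] by blast
  have "corner_number s a v b * corner_number s b v c * corner_number s c v a =
    (Z a * cnj (Z a)) * (Z b * cnj (Z b)) * (Z c * cnj (Z c))"
    by (simp add: Z)
  then show ?thesis by (simp add: complex_norm_square[symmetric] Z)
qed

lemma norm_corner_number:
  assumes "norm v = 1" "s = 1 \<or> s = -1"
  shows "cmod (corner_number s p v q) = norm (cross3 p v) * norm (cross3 q v)"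
  using corner_number_factors[OF assms] by (metis complex_mod_cnj norm_mult)

lemma Re_corner_number:
  assumes "norm v = 1"
  shows "Re (corner_number s p v q) = cross3 p v \<bullet> cross3 q v"
  using assms by (simp add: corner_number_def dot_cross norm_eq_1 inner_commute)

lemma Im_corner_number: "corner_number s p v q = z \<Longrightarrow> Im z = s * tp p v q"
  by (auto simp: corner_number_def)

section \<open>Gram relations and the identity for three equal sides\<close>

lemma gram_relation:
  "tp B C D *\<^sub>R A - tp A C D *\<^sub>R B + tp A B D *\<^sub>R C - tp A B C *\<^sub>R D = 0"
  by (simp add: vec_eq_iff tp_coords forall_3 algebra_simps)

lemma tp_product:
  "tp a b c * tp d e f =
    (a \<bullet> d) * ((b \<bullet> e) * (c \<bullet> f) - (b \<bullet> f) * (c \<bullet> e))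
    - (a \<bullet> e) * ((b \<bullet> d) * (c \<bullet> f) - (b \<bullet> f) * (c \<bullet> d))
    + (a \<bullet> f) * ((b \<bullet> d) * (c \<bullet> e) - (b \<bullet> e) * (c \<bullet> d))"
  by (simp add: tp_coords inner_vec_def sum_3) algebra

text \<open>The polynomial is the Gram determinant of four vectors in three-space, which are
  linearly dependent by \<open>gram_relation\<close>.\<close>

lemma gram_det_eq_0:
  fixes A B C D :: "real^3"
  assumes "norm A = 1" "norm B = 1" "norm C = 1" "norm D = 1"
    and "A \<bullet> B = k" "B \<bullet> C = k" "C \<bullet> D = k" "D \<bullet> A = l" "A \<bullet> C = P" "B \<bullet> D = R"
  shows "1 - 3 * k\<^sup>2 + 2 * k\<^sup>2 * R - R\<^sup>2 + k^4 + 2 * k\<^sup>2 * P - 2 * k^3 * l - 2 * k\<^sup>2 * P * R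
    + 2 * k * l * R - P\<^sup>2 + 2 * k * l * P + P\<^sup>2 * R\<^sup>2 - 2 * k * l * P * R - l\<^sup>2 + k\<^sup>2 * l\<^sup>2 = 0"
proof -
  have ips: "A \<bullet> A = 1" "B \<bullet> B = 1" "C \<bullet> C = 1" "D \<bullet> D = 1"
    "A \<bullet> B = k" "B \<bullet> A = k" "B \<bullet> C = k" "C \<bullet> B = k" "C \<bullet> D = k" "D \<bullet> C = k"
    "D \<bullet> A = l" "A \<bullet> D = l" "A \<bullet> C = P" "C \<bullet> A = P" "B \<bullet> D = R" "D \<bullet> B = R"
    using assms by (simp_all add: norm_eq_1 inner_commute)
  \<comment> \<open>This is the expansion of the Gram determinant along its first row, each minor
    being a product of two triple products.\<close>
  have "tp B C D * (A \<bullet> (tp B C D *\<^sub>R A - tp A C D *\<^sub>R B + tp A B D *\<^sub>R C - tp A B C *\<^sub>R D)) = 0"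
    by (simp only: gram_relation) simp
  then have "(tp B C D * tp B C D) - (tp B C D * tp A C D) * k + (tp B C D * tp A B D) * P - (tp B C D * tp A B C) * l = 0"
    by (simp add: inner_simps ips algebra_simps)
  then show ?thesis unfolding tp_product ips by algebra
qed

text \<open>Coolsaet's identity \<open>sin (\<beta>/2) sin (\<alpha> - \<gamma>/2) = sin (\<gamma>/2) sin (\<delta> - \<beta>/2)\<close> for three equal
  consecutive sides, squared and cleared of half-angles and denominators.\<close>
lemma three_equal_sides_identity:
  fixes A B C D :: "real^3"
  assumes "norm A = 1" "norm B = 1" "norm C = 1" "norm D = 1" "s = 1 \<or> s = -1"
    and "A \<bullet> B = k" "B \<bullet> C = k" "C \<bullet> D = k" "D \<bullet> A = l" "A \<bullet> C = P" "B \<bullet> D = R"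
  defines "zA \<equiv> corner_number s D A B" and "zB \<equiv> corner_number s A B C"
    and "zC \<equiv> corner_number s B C D" and "zD \<equiv> corner_number s C D A"
  shows "(1 - P) * ((1 - k\<^sup>2)\<^sup>2 * (1 - l\<^sup>2) - Re (zA\<^sup>2 * cnj zC)) =
    (1 - R) * ((1 - k\<^sup>2)\<^sup>2 * (1 - l\<^sup>2) - Re (zD\<^sup>2 * cnj zB))"
proof -
  have ips: "A \<bullet> A = 1" "B \<bullet> B = 1" "C \<bullet> C = 1" "D \<bullet> D = 1"
    "A \<bullet> B = k" "B \<bullet> A = k" "B \<bullet> C = k" "C \<bullet> B = k" "C \<bullet> D = k" "D \<bullet> C = k"
    "D \<bullet> A = l" "A \<bullet> D = l" "A \<bullet> C = P" "C \<bullet> A = P" "B \<bullet> D = R" "D \<bullet> B = R"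
    using assms by (simp_all add: norm_eq_1 inner_commute)
  have ss: "s * s = 1" using assms(5) by auto
  \<comment> \<open>Imaginary parts occur only in products of two, so \<open>s\<close> cancels and
    \<open>tp_product\<close> makes everything polynomial in \<open>k\<close>, \<open>l\<close>,
    \<open>P\<close>, \<open>R\<close>.\<close>
  have y: "(s * tp D A B)\<^sup>2 = tp D A B * tp D A B" "(s * tp C D A)\<^sup>2 = tp C D A * tp C D A"
    "(s * tp D A B) * (s * tp B C D) = tp D A B * tp B C D" "(s * tp C D A) * (s * tp A B C) = tp C D A * tp A B C"
    using ss by algebra+
  have sq: "Re (z\<^sup>2 * cnj z') = ((Re z)\<^sup>2 - (Im z)\<^sup>2) * Re z' + 2 * Re z * (Im z * Im z')" for z z'
    by (simp add: power2_eq_square algebra_simps)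
  have "Re (zA\<^sup>2 * cnj zC) = ((R - l * k)\<^sup>2 - tp D A B * tp D A B) * (R - k * k) + 2 * (R - l * k) * (tp D A B * tp B C D)"
    unfolding sq unfolding zA_def zC_def corner_number_def complex.sel y ips by simp
  moreover have "Re (zD\<^sup>2 * cnj zB) = ((P - k * l)\<^sup>2 - tp C D A * tp C D A) * (P - k * k) + 2 * (P - k * l) * (tp C D A * tp A B C)"
    unfolding sq unfolding zD_def zB_def corner_number_def complex.sel y ips by simp
  \<comment> \<open>The two sides agree modulo the Gram determinant.\<close>
  ultimately show ?thesis
    using gram_det_eq_0[OF assms(1-4,6-11)] unfolding tp_product ips by algebra
qed

section \<open>Corners and sides of a spherical quadrangle\<close>

text \<open>\<open>K\<close> stands for the rest of the boundary curve; being closed and free of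
  \<open>v\<close>, it is invisible near \<open>v\<close>. Each corner of a quadrangle is an
  instance.\<close>

locale corner =
  fixes p v q :: "real^3" and K C :: "(real^3) set"
  assumes unit: "norm p = 1" "norm v = 1" "norm q = 1"
    and not_antipodal: "p \<noteq> - v" "v \<noteq> - q"
    and cross_nz: "cross3 p v \<noteq> 0" "cross3 v q \<noteq> 0"
    and arcs_meet: "garc p v \<inter> garc v q = {v}"
    and closed_rest: "closed K" and rest: "v \<notin> K" "oarc p v \<inter> K = {}" "oarc v q \<inter> K = {}"
    and component: "C \<in> components (sphere 0 1 - (garc p v \<union> garc v q \<union> K))"
begin

lemma reverse: "corner q v p K C"
proof
  show "C \<in> components (sphere 0 1 - (garc q v \<union> garc v p \<union> K))"
    using component by (simp add: garc_commute Un_commute)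
  show "garc q v \<inter> garc v p = {v}"
    using arcs_meet by (simp add: garc_commute Int_commute)
qed (use unit not_antipodal cross_nz closed_rest rest in
      \<open>auto simp: oarc_commute cross_skew[of q v] cross_skew[of v p]\<close>)

lemma tp_arcs:
  "x \<in> garc p v \<Longrightarrow> \<exists>r\<ge>0. tp v q x = r * tp p v q"
  "x \<in> garc v q \<Longrightarrow> \<exists>r\<ge>0. tp p v x = r * tp p v q"
  using unit not_antipodal
  by (auto simp: garc_iff tp_linear) (metis tp_cycle)

lemma sector_avoids_arcs:
  assumes "x \<in> sector s p v q"
  shows "x \<notin> garc p v \<union> garc v q"
proof
  assume x: "x \<in> garc p v \<union> garc v q"
  show False
  proof (cases "0 < s * tp p v q")
    case True
    then show False using assms x by (auto simp: sector_def tp_garc)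
  next
    case False
    have *: "\<not> 0 < s * (r * tp p v q)" if "0 \<le> r" for r
      using False that by (metis mult.left_commute mult_nonneg_nonpos not_less)
    from x show False
    proof
      assume x: "x \<in> garc p v"
      then obtain r where "r \<ge> 0" "tp v q x = r * tp p v q" using tp_arcs by blast
      then show False using * assms False tp_garc[OF x] by (auto simp: sector_def)
    next
      assume x: "x \<in> garc v q"
      then obtain r where "r \<ge> 0" "tp p v x = r * tp p v q" using tp_arcs by blast
      then show False using * assms False tp_garc[OF x] by (auto simp: sector_def)
    qed
  qed
qed

text \<open>For an angle below \<open>pi\<close> the cap is a slice. Otherwise it is a union of two
  half caps, which overlap unless their normals are opposite; that would be a zero angle, excluded
  by \<open>wedge_nondegenerate\<close>.\<close>

lemma connected_corner_cap:
  assumes "0 \<le> c" "c < 1" "s \<noteq> 0"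
  shows "connected (corner_cap s p v q c)"
proof -
  let ?n = "s *\<^sub>R cross3 p v" and ?m = "s *\<^sub>R cross3 v q"
  let ?S = "\<lambda>n m. {x. norm x = 1 \<and> c < x \<bullet> v \<and> 0 < n \<bullet> x \<and> 0 < m \<bullet> x}"
  have S: "connected (?S n m)" for n m
    by (rule connected_sphere_slice[OF assms(1)])
  show ?thesis
  proof (cases "0 < s * tp p v q")
    case True
    then have "corner_cap s p v q c = ?S ?n ?m"
      by (auto simp: corner_cap_def sector_def tp_def)
    then show ?thesis by (simp only: S)
  next
    case False
    then have "corner_cap s p v q c = ?S ?n ?n \<union> ?S ?m ?m"
      by (auto simp: corner_cap_def sector_def tp_def)
    moreover have "?S ?n ?n \<inter> ?S ?m ?m \<noteq> {}"
    proof -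
      define n m where "n = ?n" and "m = ?m"
      have nz: "norm n > 0" "norm m > 0" using cross_nz assms by (auto simp: n_def m_def)
      have "n \<bullet> m = - (s\<^sup>2) * (cross3 p v \<bullet> cross3 q v)"
        using cross_skew[of v q] by (simp add: n_def m_def power2_eq_square)
      moreover have "norm n * norm m = s\<^sup>2 * (norm (cross3 p v) * norm (cross3 q v))"
        using cross_skew[of v q] by (simp add: n_def m_def power2_eq_square)
      ultimately have "n \<bullet> m \<noteq> - (norm n * norm m)"
        using wedge_nondegenerate[OF unit not_antipodal cross_nz arcs_meet] assms by simp
      moreover have "- (n \<bullet> m) \<le> norm n * norm m"
        using norm_cauchy_schwarz[of "-n" m] by simp
      ultimately have pos: "norm n * norm m + n \<bullet> m > 0" by linarith
      \<comment> \<open>This vector bisects the two normals, so a small push of \<open>v\<close>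
        along it enters both half caps.\<close>
      define u where "u = norm m *\<^sub>R n + norm n *\<^sub>R m"
      have "n \<bullet> u = norm n * (norm n * norm m + n \<bullet> m)"
        by (simp add: u_def inner_simps algebra_simps power2_norm_eq_inner[symmetric] power2_eq_square)
      moreover have "m \<bullet> u = norm m * (norm n * norm m + n \<bullet> m)"
        by (simp add: u_def inner_simps algebra_simps power2_norm_eq_inner[symmetric] power2_eq_square inner_commute[of m n])
      ultimately have u: "n \<bullet> u > 0" "m \<bullet> u > 0" using pos nz by auto
      have v: "n \<bullet> v = 0" "m \<bullet> v = 0" by (auto simp: n_def m_def dot_cross_self)
      have "v \<in> {x. c < x \<bullet> v}" using assms unit by (simp add: norm_eq_1)
      then obtain \<eta> where e: "0 < \<eta>" "norm (v + \<eta> *\<^sub>R u) > 0" "sgn (v + \<eta> *\<^sub>R u) \<in> {x. c < x \<bullet> v}"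
        using sgn_approach[of v "{x. c < x \<bullet> v}" u] open_cap unit by metis
      have sg: "w \<bullet> sgn x = (w \<bullet> x) / norm x" for w x :: "real^3"
        by (simp add: sgn_div_norm divide_inverse mult.commute)
      have "0 < n \<bullet> sgn (v + \<eta> *\<^sub>R u)" "0 < m \<bullet> sgn (v + \<eta> *\<^sub>R u)"
        unfolding sg using e u v by (auto simp: inner_add_right intro!: divide_pos_pos)
      then have "sgn (v + \<eta> *\<^sub>R u) \<in> ?S n n \<inter> ?S m m"
        using e by (auto simp: norm_sgn)
      then show ?thesis unfolding n_def m_def by blast
    qed
    ultimately show ?thesis using connected_Un[OF S[of ?n ?n] S[of ?m ?m]] by presburger
  qed
qed

lemma corner_dichotomy:
  assumes "s \<noteq> 0"
  obtains c where "0 \<le> c" "c < 1" "corner_cap s p v q c \<subseteq> C \<or> corner_cap s p v q c \<inter> C = {}"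
proof -
  obtain c where c: "0 \<le> c" "c < 1" "\<And>x. norm x = 1 \<Longrightarrow> c < x \<bullet> v \<Longrightarrow> x \<notin> K"
    using cap_avoiding_closed[OF closed_rest rest(1) unit(2)] by metis
  have "corner_cap s p v q c \<subseteq> sphere 0 1 - (garc p v \<union> garc v q \<union> K)"
    using c sector_avoids_arcs by (auto simp: corner_cap_def)
  then show thesis
    using component_dichotomy[OF component connected_corner_cap] c that assms by metis
qed

text \<open>The second arc is counted with \<open>K\<close> here; it misses the open first arc,
  because the two closed arcs share only \<open>v\<close>.\<close>

lemma
  assumes y: "y \<in> oarc p v"
  shows in_edge_dichotomy:
      "\<exists>c. 0 \<le> c \<and> c < 1 \<and> (half_cap s p v y c \<subseteq> C \<or> half_cap s p v y c \<inter> C = {})"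
    and in_edge_const:
      "z \<in> oarc p v \<Longrightarrow> s \<noteq> 0 \<Longrightarrow> edge_at s C p v y = edge_at s C p v z"
proof -
  have K: "closed (garc v q \<union> K)" using closed_garc unit not_antipodal closed_rest by blast
  have "v \<notin> oarc p v" using ends_notin_oarc cross_nz by blast
  moreover have "oarc p v \<subseteq> garc p v"
    by (rule oarc_subset_garc) (use unit not_antipodal in auto)
  moreover have "x \<in> garc p v \<Longrightarrow> x \<in> garc v q \<Longrightarrow> x = v" for x
    using arcs_meet by (metis IntI singletonD)
  ultimately have d: "oarc p v \<inter> (garc v q \<union> K) = {}"
    using rest(2) unfolding disjoint_iff Un_iff subset_iff by metis
  have C: "C \<in> components (sphere 0 1 - (garc p v \<union> (garc v q \<union> K)))"
    using component by (simp add: Un_assoc)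
  show "\<exists>c. 0 \<le> c \<and> c < 1 \<and> (half_cap s p v y c \<subseteq> C \<or> half_cap s p v y c \<inter> C = {})"
    using edge_dichotomy[OF unit(1,2) not_antipodal(1) K d C y] by metis
  show "z \<in> oarc p v \<Longrightarrow> s \<noteq> 0 \<Longrightarrow> edge_at s C p v y = edge_at s C p v z"
    using edge_at_const[OF unit(1,2) not_antipodal(1) cross_nz(1) K d C y] by metis
qed

text \<open>Points of the first arc approach \<open>v\<close>, and their half caps meet every corner
  cap at \<open>v\<close>. By the two dichotomies one piece lies in \<open>C\<close> as soon as the
  other does.\<close>

lemma corner_iff_edge:
  assumes "y \<in> oarc p v" "s \<noteq> 0"
  shows "corner_at s C p v q \<longleftrightarrow> edge_at s C p v y"
proof -
  obtain c where c: "0 \<le> c" "c < 1" "corner_cap s p v q c \<subseteq> C \<or> corner_cap s p v q c \<inter> C = {}"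
    using corner_dichotomy[OF assms(2)] by metis
  define U where "U c' = {x. c' < x \<bullet> v}" for c'
  \<comment> \<open>The sizes \<open>f z\<close> vary with \<open>z\<close>, so \<open>z\<close> is
    placed close to \<open>v\<close> first and the common point \<open>x\<close> is chosen close to
    \<open>z\<close> afterwards.\<close>
  have meet: "\<exists>z x. z \<in> oarc p v \<and> x \<in> corner_cap s p v q c' \<and> P z \<and> x \<in> half_cap s p v z (f z)"
    if "c' < 1" "\<And>z. z \<in> oarc p v \<Longrightarrow> f z < 1 \<and> P z" for c' f P
  proof -
    have "v \<in> U c'" using that unit by (simp add: norm_eq_1 U_def)
    then obtain z where z: "z \<in> oarc p v" "z \<in> U c'"
      using oarc_near_end[of p v "U c'"] unit open_cap unfolding U_def by metis
    then have nz: "norm z = 1" "tp p v z = 0" using tp_oarc by (auto simp: oarc_def)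
    \<comment> \<open>For an angle below \<open>pi\<close>, \<open>x\<close> must also be on the
      \<open>s\<close>-side of the second arc; this holds at \<open>z\<close> and is an open
      condition.\<close>
    define W where "W = U c' \<inter> {x. f z < x \<bullet> z} \<inter> (if 0 < s * tp p v q then {x. 0 < s * tp v q x} else UNIV)"
    have "open W" unfolding W_def U_def by (auto intro!: open_Int open_cap open_tp_pos)
    moreover have "z \<in> W"
    proof -
      obtain r t where "r > 0" "z = r *\<^sub>R p + t *\<^sub>R v" using z by (auto simp: oarc_def)
      then have "tp v q z = r * tp p v q" by (simp add: tp_linear tp_cycle[of p v q])
      then have "0 < s * tp v q z" if "0 < s * tp p v q"
        using that \<open>r > 0\<close> by (metis mult.left_commute mult_pos_pos)
      then show ?thesis
        using z that nz by (simp add: W_def norm_eq_1)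
    qed
    ultimately obtain x where x: "x \<in> W" "norm x = 1" "0 < s * tp p v x"
      using half_side_approach[OF nz cross_nz(1) assms(2)] by metis
    then have "x \<in> corner_cap s p v q c'" "x \<in> half_cap s p v z (f z)"
      by (auto simp: W_def U_def corner_cap_def half_cap_def sector_def split: if_splits)
    then show ?thesis using z that by blast
  qed
  show ?thesis
  proof
    assume "corner_at s C p v q"
    then obtain c' where c': "c' < 1" "corner_cap s p v q c' \<subseteq> C" by (auto simp: corner_at_def)
    have "\<forall>z. \<exists>d. z \<in> oarc p v \<longrightarrow> d < 1 \<and> (half_cap s p v z d \<subseteq> C \<or> half_cap s p v z d \<inter> C = {})"
      using in_edge_dichotomy by metis
    then obtain f where f: "\<And>z. z \<in> oarc p v \<Longrightarrow> f z < 1 \<and> (half_cap s p v z (f z) \<subseteq> C \<or> half_cap s p v z (f z) \<inter> C = {})"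
      by metis
    have "\<exists>z x. z \<in> oarc p v \<and> x \<in> corner_cap s p v q c' \<and> f z < 1 \<and> x \<in> half_cap s p v z (f z)"
      by (rule meet[OF c'(1)]) (use f in blast)
    then obtain z where "z \<in> oarc p v" "f z < 1" "half_cap s p v z (f z) \<subseteq> C"
      using c'(2) f by blast
    then have "edge_at s C p v z" by (auto simp: edge_at_def)
    then show "edge_at s C p v y" using in_edge_const[OF assms(1)] assms \<open>z \<in> oarc p v\<close> by metis
  next
    assume "edge_at s C p v y"
    then have "\<forall>z. \<exists>d. z \<in> oarc p v \<longrightarrow> d < 1 \<and> half_cap s p v z d \<subseteq> C"
      using in_edge_const[OF assms(1)] assms unfolding edge_at_def by metis
    then obtain f where f: "\<And>z. z \<in> oarc p v \<Longrightarrow> f z < 1 \<and> half_cap s p v z (f z) \<subseteq> C"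
      by metis
    have "\<exists>z x. z \<in> oarc p v \<and> x \<in> corner_cap s p v q c \<and> half_cap s p v z (f z) \<subseteq> C \<and> x \<in> half_cap s p v z (f z)"
      by (rule meet[OF c(2)]) (use f in blast)
    then have "corner_cap s p v q c \<inter> C \<noteq> {}" by blast
    then show "corner_at s C p v q" using c by (auto simp: corner_at_def)
  qed
qed

lemma corner_iff_side: "s \<noteq> 0 \<Longrightarrow> corner_at s C p v q \<longleftrightarrow> side s C p v"
  unfolding side_def using corner_iff_edge oarc_nonempty[OF unit(1,2) not_antipodal(1)] by metis

lemma side_iff_edge: "s \<noteq> 0 \<Longrightarrow> y \<in> oarc p v \<Longrightarrow> side s C p v \<longleftrightarrow> edge_at s C p v y"
  using corner_iff_edge corner_iff_side by blast

lemma corner_iff_side': "s \<noteq> 0 \<Longrightarrow> corner_at s C p v q \<longleftrightarrow> side s C v q"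
  using corner.corner_iff_side[OF reverse, of "- s"] by (simp add: corner_at_reverse side_reverse)

end

lemma component_contains_cap:
  fixes x :: "'a::euclidean_space"
  assumes "closed G" "X \<in> components (sphere 0 1 - G)" "x \<in> X"
  obtains c where "0 \<le> c" "c < 1" "\<And>z. norm z = 1 \<Longrightarrow> c < z \<bullet> x \<Longrightarrow> z \<in> X"
proof -
  have x: "norm x = 1" "x \<notin> G" using assms in_components_subset by fastforce+
  then obtain c where c: "0 \<le> c" "c < 1" "\<And>z. norm z = 1 \<Longrightarrow> c < z \<bullet> x \<Longrightarrow> z \<notin> G"
    using cap_avoiding_closed[OF assms(1)] by metis
  \<comment> \<open>With both normals equal to \<open>x\<close> and \<open>0 \<le> c\<close> the
    slice is the full cap.\<close>
  let ?S = "{z. norm z = 1 \<and> c < z \<bullet> x \<and> 0 < x \<bullet> z \<and> 0 < x \<bullet> z}"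
  have "?S \<subseteq> sphere 0 1 - G" using c by auto
  moreover have "connected ?S" by (rule connected_sphere_slice[OF c(1)])
  ultimately have "?S \<subseteq> X \<or> ?S \<inter> X = {}" using component_dichotomy[OF assms(2)] by blast
  moreover have "x \<in> ?S" using x c by (simp add: norm_eq_1)
  ultimately have "?S \<subseteq> X" using assms(3) by blast
  show thesis
    by (rule that[OF c(1,2)]) (use \<open>?S \<subseteq> X\<close> c in \<open>auto simp: inner_commute\<close>)
qed

section \<open>Quadrangles and the side of the boundary on which their region lies\<close>

definition quad_bd :: "real^3 \<Rightarrow> real^3 \<Rightarrow> real^3 \<Rightarrow> real^3 \<Rightarrow> (real^3) set" where
  "quad_bd A B C D = garc A B \<union> garc B C \<union> garc C D \<union> garc D A"

lemma qbd_quad: "qbd [A, B, C, D] = quad_bd A B C D"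
proof -
  have "{..<4::nat} = {0, 1, 2, 3}" by auto
  moreover have "(0 + 1) mod 4 = (1::nat)" "(1 + 1) mod 4 = (2::nat)" "(2 + 1) mod 4 = (3::nat)" "(3 + 1) mod 4 = (0::nat)"
    by simp_all
  ultimately show ?thesis
    by (simp add: qbd_def quad_bd_def Un_assoc)
qed

text \<open>\<open>X\<close> is the open region whose closure is the tile; disjointness and germs
  are properties of the open region.\<close>

locale quad =
  fixes A B C D :: "real^3" and X :: "(real^3) set"
  assumes unit: "norm A = 1" "norm B = 1" "norm C = 1" "norm D = 1"
    and not_antipodal: "A \<noteq> - B" "B \<noteq> - C" "C \<noteq> - D" "D \<noteq> - A"
    and distinct: "distinct [A, B, C, D]"
    and adjacent: "garc A B \<inter> garc B C = {B}" "garc B C \<inter> garc C D = {C}"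
      "garc C D \<inter> garc D A = {D}" "garc D A \<inter> garc A B = {A}"
    and opposite: "garc A B \<inter> garc C D = {}" "garc B C \<inter> garc D A = {}"
    and component: "X \<in> components (sphere 0 1 - quad_bd A B C D)"

lemma sph_quadrangle_quad:
  assumes "sph_quadrangle R [A, B, C, D]"
  obtains X where "quad A B C D X" "R = closure X"
proof -
  have all4: "(\<forall>i<4. P i) \<longleftrightarrow> P 0 \<and> P 1 \<and> P 2 \<and> P (3::nat)" for P
    by (auto simp: less_Suc_eq eval_nat_numeral)
  obtain X where "X \<in> components (sphere 0 1 - qbd [A, B, C, D])" "R = closure X"
    using assms by (auto simp: sph_quadrangle_def)
  moreover have "quad A B C D X"
    using assms calculation(1) unfolding sph_quadrangle_def all4 qbd_quad
    by unfold_locales simp_all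
  ultimately show thesis using that by blast
qed

context quad
begin

lemma rotate: "quad B C D A X"
  using unit not_antipodal distinct adjacent opposite component
  by unfold_locales (auto simp: quad_bd_def Un_ac)

lemma cross_nz: "cross3 A B \<noteq> 0" "cross3 B C \<noteq> 0" "cross3 C D \<noteq> 0" "cross3 D A \<noteq> 0"
  using cross3_eq_0_unit unit not_antipodal distinct by (metis distinct_length_2_or_more)+

lemma corner_ABC: "corner A B C (garc C D \<union> garc D A) X"
proof
  have AB: "oarc A B \<subseteq> garc A B" "oarc B C \<subseteq> garc B C" and
    e: "B \<in> garc A B"
    using oarc_subset_garc garc_ends unit not_antipodal by auto
  have n: "A \<notin> oarc A B" "C \<notin> oarc B C" using ends_notin_oarc cross_nz by auto
  have a: "x \<in> garc D A \<Longrightarrow> x \<in> garc A B \<Longrightarrow> x = A" for x using adjacent(4) by (metis IntI singletonD)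
  have c: "x \<in> garc B C \<Longrightarrow> x \<in> garc C D \<Longrightarrow> x = C" for x using adjacent(2) by (metis IntI singletonD)
  show "B \<notin> garc C D \<union> garc D A" using e opposite(1) a distinct by auto
  show "oarc A B \<inter> (garc C D \<union> garc D A) = {}"
    using AB(1) opposite(1) n(1) a by (fastforce simp: disjoint_iff)
  show "oarc B C \<inter> (garc C D \<union> garc D A) = {}"
    using AB(2) opposite(2) n(2) c by (fastforce simp: disjoint_iff)
  show "closed (garc C D \<union> garc D A)" using closed_garc unit not_antipodal by blast
  show "X \<in> components (sphere 0 1 - (garc A B \<union> garc B C \<union> (garc C D \<union> garc D A)))"
    using component by (simp add: quad_bd_def Un_ac)
qed (use unit not_antipodal cross_nz adjacent in auto)

end

context quad
begin

lemmas corner_BCD = quad.corner_ABC[OF rotate]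
lemmas corner_CDA = quad.corner_ABC[OF quad.rotate[OF rotate]]
lemmas corner_DAB = quad.corner_ABC[OF quad.rotate[OF quad.rotate[OF rotate]]]

text \<open>At each corner \<open>corner_iff_side\<close> and \<open>corner_iff_side'\<close> pass
  the side from the incoming to the outgoing arc, hence around the whole boundary.\<close>

lemma side_cycle:
  assumes "s \<noteq> 0"
  shows "side s X B C \<longleftrightarrow> side s X A B" "side s X C D \<longleftrightarrow> side s X A B" "side s X D A \<longleftrightarrow> side s X A B"
  using corner.corner_iff_side[OF corner_ABC assms] corner.corner_iff_side'[OF corner_ABC assms]
    corner.corner_iff_side[OF corner_BCD assms] corner.corner_iff_side'[OF corner_BCD assms]
    corner.corner_iff_side[OF corner_CDA assms] corner.corner_iff_side'[OF corner_CDA assms]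
  by blast+

lemma corner_iff:
  assumes "s \<noteq> 0"
  shows "corner_at s X A B C \<longleftrightarrow> side s X A B" "corner_at s X B C D \<longleftrightarrow> side s X A B"
    "corner_at s X C D A \<longleftrightarrow> side s X A B" "corner_at s X D A B \<longleftrightarrow> side s X A B"
  using corner.corner_iff_side[OF corner_ABC assms] corner.corner_iff_side[OF corner_BCD assms]
    corner.corner_iff_side[OF corner_CDA assms] corner.corner_iff_side[OF corner_DAB assms]
    side_cycle[OF assms] by blast+

lemma closed_bd: "closed (quad_bd A B C D)"
  unfolding quad_bd_def using closed_garc unit not_antipodal by (intro closed_Un) auto

lemma nonempty: "X \<noteq> {}"
  using component in_components_nonempty by blast

lemma disjoint_bd: "X \<inter> quad_bd A B C D = {}" and subset_sphere: "X \<subseteq> sphere 0 1"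
  using in_components_subset[OF component] by auto

text \<open>\<open>X\<close> is open in the sphere, so it is not confined to great circles. Off the
  two great circles at \<open>B\<close>, each point lies in the sector for \<open>s = 1\<close> or
  \<open>s = -1\<close>.\<close>

lemma point_off_planes:
  assumes "open U" "X \<inter> U \<noteq> {}"
  obtains z where "z \<in> X" "z \<in> U" "tp A B z \<noteq> 0" "tp B C z \<noteq> 0"
proof -
  have step: "\<exists>z \<in> X \<inter> V. tp p q z \<noteq> 0" if V: "open V" "X \<inter> V \<noteq> {}" and nz: "cross3 p q \<noteq> 0" for V p q
  proof -
    obtain x where x: "x \<in> X" "x \<in> V" using V by blast
    then obtain c where c: "c < 1" "\<And>z. norm z = 1 \<Longrightarrow> c < z \<bullet> x \<Longrightarrow> z \<in> X"
      using component_contains_cap[OF closed_bd component] by metis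
    have nx: "norm x = 1" using x subset_sphere by auto
    show ?thesis
    proof (cases "tp p q x = 0")
      case True
      have "open (V \<inter> {z. c < z \<bullet> x})" "x \<in> V \<inter> {z. c < z \<bullet> x}"
        using V x nx c open_cap by (auto simp: norm_eq_1)
      then obtain z where "z \<in> V \<inter> {z. c < z \<bullet> x}" "norm z = 1" "0 < 1 * tp p q z"
        using half_side_approach[OF nx True nz] by (metis zero_neq_one)
      then show ?thesis using c by (intro bexI[of _ z]) auto
    qed (use x in blast)
  qed
  obtain y where y: "y \<in> X" "y \<in> U" "tp A B y \<noteq> 0" using step[OF assms cross_nz(1)] by blast
  \<comment> \<open>The first condition is open, so the second point can be sought within
    it.\<close>
  have "open (U \<inter> (tp A B -` (- {0})))"
    using assms(1) continuous_tp[of UNIV A B] by (intro open_Int open_vimage) auto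
  moreover have "X \<inter> (U \<inter> (tp A B -` (- {0}))) \<noteq> {}" using y by auto
  ultimately show thesis using step[OF _ _ cross_nz(2)] that by blast
qed

text \<open>If neither side has a germ in \<open>X\<close>, then near \<open>x\<close> the set
  \<open>X\<close> lies in two great circles, against \<open>point_off_planes\<close>.\<close>

lemma arc_in_closure:
  assumes "x \<in> oarc A B \<or> x = B" "x \<in> closure X"
  shows "side 1 X A B \<or> side (-1) X A B"
proof (rule ccontr)
  assume neg: "\<not> ?thesis"
  have "norm x = 1" using assms unit by (auto simp: oarc_def)
  have "\<exists>c<1. \<forall>z. norm z = 1 \<longrightarrow> c < z \<bullet> x \<longrightarrow> tp A B z \<noteq> 0 \<longrightarrow> tp B C z \<noteq> 0 \<longrightarrow> z \<notin> X"
    using assms(1)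
  proof
    assume x: "x \<in> oarc A B"
    have *: "\<exists>c. 0 \<le> c \<and> c < 1 \<and> half_cap s A B x c \<inter> X = {}" if "s = 1 \<or> s = -1" for s
    proof -
      have "\<not> edge_at s X A B x"
        using neg that x by (auto simp: side_def)
      then show ?thesis
        using corner.in_edge_dichotomy[OF corner_ABC x, of s] by (auto simp: edge_at_def)
    qed
    obtain c c' where "c < 1" "half_cap 1 A B x c \<inter> X = {}" "c' < 1" "half_cap (-1) A B x c' \<inter> X = {}"
      using *[of 1] *[of "-1"] by auto
    then show ?thesis
      by (intro exI[of _ "max c c'"]) (force simp: half_cap_def disjoint_iff not_less)
  next
    assume x: "x = B"
    have *: "\<exists>c. 0 \<le> c \<and> c < 1 \<and> corner_cap s A B C c \<inter> X = {}" if "s = 1 \<or> s = -1" for s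
    proof -
      have "\<not> corner_at s X A B C" "s \<noteq> 0"
        using neg that corner_iff by auto
      then show ?thesis
        using corner.corner_dichotomy[OF corner_ABC, of s] unfolding corner_at_def by metis
    qed
    obtain c c' where cc: "c < 1" "corner_cap 1 A B C c \<inter> X = {}" "c' < 1" "corner_cap (-1) A B C c' \<inter> X = {}"
      using *[of 1] *[of "-1"] by auto
    have "z \<in> sector 1 A B C \<or> z \<in> sector (-1) A B C" if "tp A B z \<noteq> 0" "tp B C z \<noteq> 0" for z
      using that by (auto simp: sector_def)
    then show ?thesis
      using cc unfolding x by (intro exI[of _ "max c c'"]) (auto simp: corner_cap_def disjoint_iff)
  qed
  then obtain c where c: "c < 1" "\<And>z. norm z = 1 \<Longrightarrow> c < z \<bullet> x \<Longrightarrow> tp A B z \<noteq> 0 \<Longrightarrow> tp B C z \<noteq> 0 \<Longrightarrow> z \<notin> X"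
    by blast
  have "x \<in> {z. c < z \<bullet> x}" using c \<open>norm x = 1\<close> by (simp add: norm_eq_1)
  then have "X \<inter> {z. c < z \<bullet> x} \<noteq> {}"
    using assms(2) open_cap by (metis Int_commute closure_iff_nhds_not_empty order_refl)
  then obtain z where "z \<in> X" "c < z \<bullet> x" "tp A B z \<noteq> 0" "tp B C z \<noteq> 0"
    using point_off_planes[OF open_cap] by blast
  then show False using c subset_sphere by auto
qed

text \<open>Otherwise \<open>closure X\<close> misses the boundary by \<open>arc_in_closure\<close>,
  and maximality of the component makes \<open>X\<close> closed. It is also open in the connected
  sphere, hence all of it, although it avoids \<open>A\<close>.\<close>

lemma some_side: "side 1 X A B \<or> side (-1) X A B"
proof (rule ccontr)
  assume neg: "\<not> ?thesis"
  have off: "x \<notin> closure X" if "quad P Q R S X" "side 1 X P Q \<longleftrightarrow> side 1 X A B" "side (-1) X P Q \<longleftrightarrow> side (-1) X A B"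
    "x \<in> oarc P Q \<or> x = Q" for x P Q R S
    using quad.arc_in_closure[OF that(1,4)] that(2,3) neg by blast
  have "closure X \<inter> quad_bd A B C D = {}"
  proof -
    have g: "garc A B \<subseteq> insert A (insert B (oarc A B))" "garc B C \<subseteq> insert B (insert C (oarc B C))"
      "garc C D \<subseteq> insert C (insert D (oarc C D))" "garc D A \<subseteq> insert D (insert A (oarc D A))"
      using garc_subset_oarc unit not_antipodal by auto
    have "x \<in> oarc A B \<or> x = B \<or> x \<in> oarc B C \<or> x = C \<or> x \<in> oarc C D \<or> x = D \<or> x \<in> oarc D A \<or> x = A"
      if "x \<in> quad_bd A B C D" for x
      using that unfolding quad_bd_def by (elim UnE) (drule g[THEN subsetD]; blast)+
    moreover have "x \<in> oarc A B \<or> x = B \<Longrightarrow> x \<notin> closure X" "x \<in> oarc B C \<or> x = C \<Longrightarrow> x \<notin> closure X"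
      "x \<in> oarc C D \<or> x = D \<Longrightarrow> x \<notin> closure X" "x \<in> oarc D A \<or> x = A \<Longrightarrow> x \<notin> closure X" for x
      using off[OF quad_axioms] off[OF rotate] off[OF quad.rotate[OF rotate]] off[OF quad.rotate[OF quad.rotate[OF rotate]]]
      by (simp_all add: side_cycle)
    ultimately show ?thesis by blast
  qed
  moreover have "closure X \<subseteq> sphere 0 1"
    using subset_sphere by (simp add: closure_minimal)
  moreover have "connected (closure X)"
    using component in_components_connected connected_imp_connected_closure by blast
  ultimately have "closure X \<subseteq> X"
    using component_dichotomy[OF component, of "closure X"] nonempty closure_subset[of X] by blast
  then have cl: "closed X" by (metis closure_subset closed_closure subset_antisym)
  have "openin (top_of_set (sphere 0 1)) X"
    unfolding openin_euclidean_subtopology_iff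
  proof (intro conjI ballI)
    fix x assume x: "x \<in> X"
    then obtain c where c: "c < 1" "\<And>z. norm z = 1 \<Longrightarrow> c < z \<bullet> x \<Longrightarrow> z \<in> X"
      using component_contains_cap[OF closed_bd component] by metis
    have "x \<in> {z. c < z \<bullet> x}" using x c subset_sphere by (auto simp: norm_eq_1)
    then obtain e where "e > 0" "ball x e \<subseteq> {z. c < z \<bullet> x}"
      using open_cap open_contains_ball by metis
    then show "\<exists>e>0. \<forall>x'\<in>sphere 0 1. dist x' x < e \<longrightarrow> x' \<in> X"
      using c by (intro exI[of _ e]) (force simp: dist_commute subset_iff)
  qed (rule subset_sphere)
  moreover have "closedin (top_of_set (sphere 0 1)) X"
    using cl subset_sphere by (simp add: closed_subset)
  moreover have "connected (sphere (0::real^3) 1)" by (rule connected_sphere) simp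
  ultimately have "X = sphere 0 1"
    using nonempty by (auto simp: connected_clopen)
  moreover have "A \<in> quad_bd A B C D" using garc_ends[of A B] unit not_antipodal by (auto simp: quad_bd_def)
  ultimately show False using disjoint_bd unit by auto
qed

end

section \<open>Behaviour under orthogonal maps\<close>

lemma orthogonal_inner: "orthogonal_transformation h \<Longrightarrow> h x \<bullet> h y = x \<bullet> y"
  by (simp add: orthogonal_transformation_def)

lemma orthogonal_combination:
  assumes "orthogonal_transformation h"
  shows "h (r *\<^sub>R p + t *\<^sub>R q) = r *\<^sub>R h p + t *\<^sub>R h q"
  using orthogonal_transformation_linear[OF assms] by (simp add: linear_add linear_cmul)

lemma orthogonal_garc:
  assumes "orthogonal_transformation h"
  shows "garc (h p) (h q) = h ` garc p q"
proof -
  have "closed_segment (h p) (h q) = h ` closed_segment p q"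
    using closed_segment_linear_image orthogonal_transformation_linear[OF assms] by metis
  moreover have "h x /\<^sub>R norm (h x) = h (x /\<^sub>R norm x)" for x
    using assms by (simp add: orthogonal_transformation_norm linear_cmul orthogonal_transformation_linear)
  ultimately show ?thesis by (simp add: garc_def image_image)
qed

lemma orthogonal_oarc:
  assumes "orthogonal_transformation h"
  shows "oarc (h p) (h q) = h ` oarc p q"
proof -
  have "x \<in> oarc p q \<Longrightarrow> h x \<in> oarc (h p) (h q)" for x
    using assms by (auto simp: oarc_def orthogonal_combination orthogonal_transformation_norm) blast
  moreover have "x \<in> h ` oarc p q" if x: "x \<in> oarc (h p) (h q)" for x
  proof -
    obtain r t where "norm x = 1" "r > 0" "t > 0" "x = r *\<^sub>R h p + t *\<^sub>R h q"
      using x by (auto simp: oarc_def)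
    moreover from this have "x = h (r *\<^sub>R p + t *\<^sub>R q)" using assms by (simp add: orthogonal_combination)
    ultimately have "r *\<^sub>R p + t *\<^sub>R q \<in> oarc p q"
      using orthogonal_transformation_norm[OF assms, of "r *\<^sub>R p + t *\<^sub>R q"] by (auto simp: oarc_def)
    then show ?thesis using \<open>x = h _\<close> by blast
  qed
  ultimately show ?thesis by blast
qed

lemma orthogonal_image_Collect:
  fixes h :: "real^3 \<Rightarrow> real^3"
  assumes "orthogonal_transformation h" "\<And>x. P (h x) \<longleftrightarrow> R x"
  shows "{x. P x} = h ` {x. R x}"
proof -
  have "x \<in> h ` {x. R x}" if "P x" for x
    using that assms(2) surjD[OF orthogonal_transformation_surj[OF assms(1)], of x] by auto
  then show ?thesis using assms(2) by auto
qed

lemma orthogonal_component: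
  fixes h :: "real^3 \<Rightarrow> real^3"
  assumes h: "orthogonal_transformation h" and X: "X \<in> components (sphere 0 1 - G)"
  shows "h ` X \<in> components (sphere 0 1 - h ` G)"
proof -
  have inj: "inj h" using h by (rule orthogonal_transformation_inj)
  have "h ` sphere 0 1 = sphere 0 1"
    using orthogonal_image_Collect[OF h, of "\<lambda>x. x \<in> sphere 0 1" "\<lambda>x. x \<in> sphere 0 1"] h
    by (simp add: orthogonal_transformation_norm sphere_def)
  then have img: "h ` (sphere 0 1 - G) = sphere 0 1 - h ` G"
    by (simp add: image_set_diff[OF inj])
  have inv: "h ` inv h ` S = S" "inv h ` h ` S = S" for S
    using inj orthogonal_transformation_surj[OF h] by (simp_all add: image_f_inv_f)
  have conn: "connected S \<Longrightarrow> connected (h ` S)" "connected S \<Longrightarrow> connected (inv h ` S)" for S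
    using h orthogonal_transformation_inv[OF h]
    by (auto intro!: connected_linear_image orthogonal_transformation_linear)
  show ?thesis
    using X unfolding img[symmetric] in_components_maximal
  proof (intro conjI allI impI; elim conjE)
    fix S assume max: "\<forall>d. d \<noteq> {} \<and> X \<subseteq> d \<and> d \<subseteq> sphere 0 1 - G \<and> connected d \<longrightarrow> d = X"
      and S: "S \<noteq> {}" "h ` X \<subseteq> S" "S \<subseteq> h ` (sphere 0 1 - G)" "connected S"
    have "X \<subseteq> inv h ` S" "inv h ` S \<subseteq> sphere 0 1 - G"
      using image_mono[OF S(2), of "inv h"] image_mono[OF S(3), of "inv h"] by (simp_all add: inv)
    then have "inv h ` S = X" using max[rule_format, of "inv h ` S"] S(1,4) conn(2) by simp
    then show "S = h ` X" using inv by metis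
  next
    show "h ` X \<subseteq> h ` (sphere 0 1 - G)" if "X \<subseteq> sphere 0 1 - G"
      using that by (rule image_mono)
    show "connected (h ` X)" if "connected X"
      using that by (rule conn)
  qed simp
qed

text \<open>Carrying the sign \<open>e\<close> along lets every notion be transported uniformly,
  with \<open>s\<close> replaced by \<open>e * s\<close>.\<close>

locale orthogonal_map =
  fixes h :: "real^3 \<Rightarrow> real^3" and e :: real
  assumes orth: "orthogonal_transformation h" and e: "e = 1 \<or> e = -1"
    and tp: "\<And>p q x. tp (h p) (h q) (h x) = e * tp p q x"
begin

lemma e_cancel: "e * s * (e * t) = s * t"
  using e by auto

lemma half_cap: "half_cap (e * s) (h p) (h q) (h y) c = h ` half_cap s p q y c"
  unfolding half_cap_def using orth e
  by (intro orthogonal_image_Collect[OF orth]) (auto simp: tp orthogonal_transformation_norm orthogonal_inner)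

lemma corner_cap: "corner_cap (e * s) (h p) (h v) (h q) c = h ` corner_cap s p v q c"
  unfolding corner_cap_def
  by (intro orthogonal_image_Collect[OF orth])
    (simp add: tp orthogonal_transformation_norm[OF orth] orthogonal_inner[OF orth] sector_def e_cancel)

lemma side: "side (e * s) (h ` X) (h p) (h q) = side s X p q"
  by (simp add: side_def edge_at_def orthogonal_oarc[OF orth] half_cap
      inj_image_subset_iff[OF orthogonal_transformation_inj[OF orth]])

lemma corner_at: "corner_at (e * s) (h ` X) (h p) (h v) (h q) = corner_at s X p v q"
  by (simp add: corner_at_def corner_cap inj_image_subset_iff[OF orthogonal_transformation_inj[OF orth]])

lemma corner_number: "corner_number (e * s) (h p) (h v) (h q) = corner_number s p v q"
  using e by (auto simp: corner_number_def tp orthogonal_inner[OF orth])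

lemma quad_bd: "quad_bd (h A) (h B) (h C) (h D) = h ` quad_bd A B C D"
  by (simp add: quad_bd_def orthogonal_garc[OF orth] image_Un)

lemma quad:
  assumes "quad A B C D X"
  shows "quad (h A) (h B) (h C) (h D) (h ` X)"
proof -
  interpret quad A B C D X by fact
  have inj: "inj h" using orth by (rule orthogonal_transformation_inj)
  have neg: "h x = - h y \<longleftrightarrow> x = - y" for x y
    using linear_neg[OF orthogonal_transformation_linear[OF orth], of y] inj_eq[OF inj, of x "- y"] by simp
  note img = orthogonal_garc[OF orth] image_Int[OF inj, symmetric] quad_bd
  show ?thesis
    using unit not_antipodal distinct orthogonal_component[OF orth component]
    by unfold_locales
      (simp_all add: orthogonal_transformation_norm[OF orth] neg inj_eq[OF inj] img adjacent opposite)
qed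

end

lemma orthogonal_map_exists:
  assumes "orthogonal_transformation h"
  obtains e where "orthogonal_map h e"
  using tp_orthogonal[OF assms] assms by (metis orthogonal_map.intro)

lemma quad_reverse:
  assumes "quad A B C D X"
  shows "quad D C B A X"
proof -
  interpret quad A B C D X by fact
  note g = garc_commute[of D C] garc_commute[of C B] garc_commute[of B A] garc_commute[of A D]
  have "quad_bd D C B A = quad_bd A B C D" unfolding quad_bd_def g by blast
  moreover have "garc C D \<inter> garc B C = {C}" "garc B C \<inter> garc A B = {B}" "garc A B \<inter> garc D A = {A}"
    "garc D A \<inter> garc C D = {D}" "garc C D \<inter> garc A B = {}" "garc B C \<inter> garc D A = {}"
    using adjacent opposite by (simp_all only: Int_commute)
  moreover have "D \<noteq> - C" "C \<noteq> - B" "B \<noteq> - A" "A \<noteq> - D"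
    using not_antipodal by auto
  moreover have "distinct [D, C, B, A]" using distinct by auto
  ultimately show ?thesis
    using unit component by unfold_locales (simp_all add: g)
qed

text \<open>The prolongation of the arc from \<open>w\<close> beyond \<open>v\<close> runs inside
  both concave sectors.\<close>

lemma concave_corners_overlap:
  assumes "norm v = 1" "corner_at s Y w v u" "corner_at (- s) Y' w v u'"
    and "s * tp w v u < 0" "- s * tp w v u' < 0"
  shows "Y \<inter> Y' \<noteq> {}"
proof -
  obtain c c' where c: "c < 1" "corner_cap s w v u c \<subseteq> Y" "c' < 1" "corner_cap (- s) w v u' c' \<subseteq> Y'"
    using assms by (auto simp: corner_at_def)
  have "v \<in> {x. max c c' < x \<bullet> v}" using assms c by (simp add: norm_eq_1)
  then obtain \<eta> where e: "0 < \<eta>" "norm (v + \<eta> *\<^sub>R (- w)) > 0" "sgn (v + \<eta> *\<^sub>R (- w)) \<in> {x. max c c' < x \<bullet> v}"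
    using sgn_approach[of v "{x. max c c' < x \<bullet> v}" "- w"] open_cap assms(1) by metis
  let ?x = "v + \<eta> *\<^sub>R (- w)"
  have *: "s * tp v u (sgn ?x) > 0" if "s * tp w v u < 0" for s u
  proof -
    have "s * tp v u (sgn ?x) = (\<eta> / norm ?x) * (- (s * tp w v u))"
      unfolding tp_sgn tp_linear by (simp add: tp_cycle[of w v u])
    also have "\<dots> > 0" using e that by (intro mult_pos_pos divide_pos_pos) auto
    finally show ?thesis .
  qed
  have "sgn ?x \<in> corner_cap s w v u c \<inter> corner_cap (- s) w v u' c'"
    using e assms(4,5) *[OF assms(4)] *[OF assms(5)] by (auto simp: corner_cap_def sector_def norm_sgn)
  then show ?thesis using c by blast
qed

section \<open>Labelled wheels of congruent tiles\<close>

lemma dihedral_eq_4: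
  "dihedral_eq [p, q, r, t] ys \<longleftrightarrow>
    ys \<in> {[p,q,r,t], [q,r,t,p], [r,t,p,q], [t,p,q,r], [t,r,q,p], [r,q,p,t], [q,p,t,r], [p,t,r,q]}"
proof -
  have "(\<exists>k. ys = rotate k xs) \<longleftrightarrow> (\<exists>k<4. ys = rotate k xs)" if "length xs = 4" for xs :: "'a list"
    using rotate_conv_mod[of _ xs] that by (metis mod_less_divisor zero_less_numeral)
  moreover have "(\<exists>k<4. P k) \<longleftrightarrow> P 0 \<or> P 1 \<or> P 2 \<or> P (3::nat)" for P
    by (auto simp: less_Suc_eq eval_nat_numeral)
  ultimately have "dihedral_eq [p, q, r, t] ys \<longleftrightarrow>
      (ys = rotate 0 [p,q,r,t] \<or> ys = rotate 1 [p,q,r,t] \<or> ys = rotate 2 [p,q,r,t] \<or> ys = rotate 3 [p,q,r,t]) \<or>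
      (ys = rotate 0 [t,r,q,p] \<or> ys = rotate 1 [t,r,q,p] \<or> ys = rotate 2 [t,r,q,p] \<or> ys = rotate 3 [t,r,q,p])"
    unfolding dihedral_eq_def ex_disj_distrib by simp
  then show ?thesis by (simp add: numeral_2_eq_2 numeral_3_eq_3)
qed

text \<open>The faces around both poles are indexed together by their vertex \<open>w j\<close> opposite to the pole, odd \<open>j\<close> for \<open>N\<close>
  and even \<open>j\<close> for \<open>S\<close>. When the \<open>b\<close>-edges are the edges \<open>w (2 i) w (2 i + 1)\<close>, \<open>partner j\<close> is the other end
  of the \<open>b\<close>-edge at \<open>w j\<close>, and tile \<open>j\<close> has either \<open>D\<close> or (\<open>T j\<close> below) \<open>A\<close> at \<open>w j\<close>.\<close>
definition partner :: "int \<Rightarrow> int" where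
  "partner j = (if even j then j + 1 else j - 1)"

definition other :: "int \<Rightarrow> int" where
  "other j = (if even j then j - 1 else j + 1)"

text \<open>Lengths are recorded by their cosines \<open>k\<close>, \<open>c\<close>,
  \<open>l\<close>. Indices are arbitrary integers, so no reduction modulo the number of tiles is
  needed; shifts by 1 and 2 reach the tiles across cycle edges and meridian edges.\<close>

locale wheel = quad A B C D X
  for A B C D :: "real^3" and X :: "(real^3) set" +
  fixes w pole :: "int \<Rightarrow> real^3" and K :: "int \<Rightarrow> (real^3) set" and k c l :: real
  assumes pole: "pole (j + 2) = pole j"
    and overlap: "d \<in> {1, 2, -1, -2} \<Longrightarrow> K j \<inter> K (j + d) \<subseteq> quad_bd (pole j) (w (j - 1)) (w j) (w (j + 1))"
    and congruent: "\<exists>h. orthogonal_transformation h \<and> h ` closure X = K j \<and>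
      dihedral_eq [pole j, w (j - 1), w j, w (j + 1)] [h A, h B, h C, h D]"
    and lengths: "A \<bullet> B = k" "B \<bullet> C = k" "C \<bullet> D = c" "D \<bullet> A = l" "l \<noteq> k" "l \<noteq> c"
    and meridian: "pole j \<bullet> w (j - 1) \<noteq> l" "pole j \<bullet> w (j + 1) \<noteq> l"
begin

text \<open>Tile \<open>j\<close> has exactly one edge of cosine \<open>l\<close>; not being
  meridian, it is one of the two cycle edges of the tile.\<close>

lemma edge_alternates: "w (j - 1) \<bullet> w j = l \<longleftrightarrow> w j \<bullet> w (j + 1) \<noteq> l"
proof -
  obtain h where h: "orthogonal_transformation h"
    "dihedral_eq [pole j, w (j - 1), w j, w (j + 1)] [h A, h B, h C, h D]"
    using congruent by blast
  have "h A \<bullet> h B = k" "h B \<bullet> h C = k" "h C \<bullet> h D = c" "h D \<bullet> h A = l"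
    using lengths by (simp_all add: orthogonal_inner[OF h(1)])
  with h(2) meridian[of j] lengths(5,6) show ?thesis
    unfolding dihedral_eq_4 by (elim insertE emptyE) (simp_all add: inner_commute)
qed

end

locale tiled_wheel = wheel +
  assumes start: "w 0 \<bullet> w 1 = l"
begin

lemma edge_even: "w j \<bullet> w (j + 1) = l \<longleftrightarrow> even j"
proof (induction j rule: int_induct[of _ 0])
  case base then show ?case using start by simp
next
  case (step1 i) then show ?case using edge_alternates[of "i + 1"] by simp
next
  case (step2 i) then show ?case using edge_alternates[of i] by simp
qed

text \<open>The corner opposite to the pole is an end of the \<open>b\<close>-edge, hence labelled
  \<open>A\<close> or \<open>D\<close>, and this determines the other labels.\<close>

lemma face_type:
  "\<exists>h t. orthogonal_transformation h \<and> h ` closure X = K j \<and>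
    (if t then [h C, h D, h A, h B] else [h B, h A, h D, h C]) = [pole j, w (partner j), w j, w (other j)]"
proof -
  obtain h where h: "orthogonal_transformation h" "h ` closure X = K j"
    "dihedral_eq [pole j, w (j - 1), w j, w (j + 1)] [h A, h B, h C, h D]"
    using congruent by blast
  have len: "h A \<bullet> h B = k" "h B \<bullet> h C = k" "h C \<bullet> h D = c" "h D \<bullet> h A = l"
    using lengths by (simp_all add: orthogonal_inner[OF h(1)])
  have "[h C, h D, h A, h B] = [pole j, w (partner j), w j, w (other j)] \<or>
    [h B, h A, h D, h C] = [pole j, w (partner j), w j, w (other j)]"
    using h(3) len meridian[of j] lengths(5,6) edge_even[of j] edge_even[of "j - 1"]
    unfolding dihedral_eq_4 partner_def other_def
    by (elim insertE emptyE; cases "even j") (simp_all add: inner_commute)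
  then show ?thesis using h by (metis (full_types))
qed

text \<open>Isometry and type are fixed by choice, since a symmetric prototile allows both types for
  one tile.\<close>

definition H :: "int \<Rightarrow> real^3 \<Rightarrow> real^3" where
  "H j = (SOME h. \<exists>t. orthogonal_transformation h \<and> h ` closure X = K j \<and>
    (if t then [h C, h D, h A, h B] else [h B, h A, h D, h C]) = [pole j, w (partner j), w j, w (other j)])"

definition T :: "int \<Rightarrow> bool" where
  "T j = (SOME t. orthogonal_transformation (H j) \<and> H j ` closure X = K j \<and>
    (if t then [H j C, H j D, H j A, H j B] else [H j B, H j A, H j D, H j C]) = [pole j, w (partner j), w j, w (other j)])"

lemma HT: "orthogonal_transformation (H j)" "H j ` closure X = K j"
    "(if T j then [H j C, H j D, H j A, H j B] else [H j B, H j A, H j D, H j C]) = [pole j, w (partner j), w j, w (other j)]"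
  using someI_ex[OF someI_ex[OF face_type[of j], folded H_def], folded T_def] by auto

text \<open>The side on which the prototile lies of its boundary traversed from \<open>A\<close> to
  \<open>B\<close>, \<open>C\<close>, \<open>D\<close>. With this sign the four corner numbers below
  encode interior angles.\<close>

definition s :: real where
  "s = (if side 1 X A B then 1 else -1)"

lemma s: "s = 1 \<or> s = -1" "side s X A B"
  using some_side by (auto simp: s_def)

definition zA where "zA = corner_number s D A B"
definition zB where "zB = corner_number s A B C"
definition zC where "zC = corner_number s B C D"
definition zD where "zD = corner_number s C D A"

text \<open>Corner numbers survive an isometry once \<open>s\<close> becomes \<open>e * s\<close>.
  The path from the pole through \<open>w (j - 1)\<close>, \<open>w j\<close>,
  \<open>w (j + 1)\<close> follows the labels forwards or backwards, depending on the parity of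
  \<open>j\<close> and on \<open>T j\<close>; backwards, \<open>s\<close> becomes
  \<open>- s\<close>.\<close>

lemma oriented_tile:
  "\<exists>\<sigma>. (\<sigma> = 1 \<or> \<sigma> = -1) \<and> quad (pole j) (w (j - 1)) (w j) (w (j + 1)) (H j ` X) \<and>
    side \<sigma> (H j ` X) (pole j) (w (j - 1)) \<and>
    corner_number \<sigma> (w (j - 1)) (w j) (w (j + 1)) = (if T j then zA else zD) \<and>
    corner_number \<sigma> (w j) (w (j + 1)) (pole j) =
      (if even j then if T j then zD else zA else if T j then zB else zC) \<and>
    corner_number \<sigma> (pole j) (w (j - 1)) (w j) =
      (if even j then if T j then zB else zC else if T j then zD else zA)"
proof -
  obtain e where e: "orthogonal_map (H j) e" using orthogonal_map_exists[OF HT(1)] by metis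
  interpret h: orthogonal_map "H j" e by fact
  have *: ?thesis
    if P: "quad P0 P1 P2 P3 X" "[H j P0, H j P1, H j P2, H j P3] = [pole j, w (j - 1), w j, w (j + 1)]"
      "t = 1 \<or> t = -1" "side t X P0 P1"
      "corner_number t P1 P2 P3 = (if T j then zA else zD)"
      "corner_number t P2 P3 P0 = (if even j then if T j then zD else zA else if T j then zB else zC)"
      "corner_number t P0 P1 P2 = (if even j then if T j then zB else zC else if T j then zD else zA)"
    for P0 P1 P2 P3 t
  proof -
    have "e * t = 1 \<or> e * t = -1" using h.e P(3) by auto
    moreover have "H j P0 = pole j" "H j P1 = w (j - 1)" "H j P2 = w j" "H j P3 = w (j + 1)"
      using P(2) by simp_all
    ultimately show ?thesis
      using h.quad[OF P(1)] h.side[of t X P0 P1] P(4-7) h.corner_number[of t P1 P2 P3]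
        h.corner_number[of t P2 P3 P0] h.corner_number[of t P0 P1 P2]
      by (intro exI[of _ "e * t"]) simp
  qed
  note q = quad_axioms quad.rotate[OF quad_axioms] quad.rotate[OF quad.rotate[OF quad_axioms]]
  have s0: "s \<noteq> 0" using s by auto
  note sides = side_cycle[OF s0] s(2)
  have r: "side (- s) X Q P = side s X P Q" "corner_number (- s) Q V P = corner_number s P V Q" for P Q V
    by (rule side_reverse, rule corner_number_reverse)
  note z = zA_def zB_def zC_def zD_def
  have ms: "- s = 1 \<or> - s = -1" using s by auto
  show ?thesis
  proof (cases "T j")
    case True
    note HT3 = HT(3)[of j, unfolded if_P[OF True]]
    show ?thesis
    proof (cases "even j")
      case True
      show ?thesis
        by (rule *[of C B A D "- s"])
          (use quad.rotate[OF quad_reverse[OF quad_axioms]] HT3 \<open>T j\<close> True ms sides in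
            \<open>simp_all add: r z partner_def other_def\<close>)
    next
      case False
      show ?thesis
        by (rule *[of C D A B s])
          (use q HT3 \<open>T j\<close> False s sides in \<open>simp_all add: z partner_def other_def\<close>)
    qed
  next
    case False
    note HT3 = HT(3)[of j, unfolded if_not_P[OF False]]
    show ?thesis
    proof (cases "even j")
      case True
      show ?thesis
        by (rule *[of B C D A s])
          (use q HT3 \<open>\<not> T j\<close> True s sides in \<open>simp_all add: z partner_def other_def\<close>)
    next
      case odd: False
      show ?thesis
        by (rule *[of B A D C "- s"])
          (use quad.rotate[OF quad.rotate[OF quad_reverse[OF quad_axioms]]] HT3 \<open>\<not> T j\<close> odd ms sides in
            \<open>simp_all add: r z partner_def other_def\<close>)
    qed
  qed
qed

definition \<sigma> :: "int \<Rightarrow> real" where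
  "\<sigma> j = (SOME \<sigma>. (\<sigma> = 1 \<or> \<sigma> = -1) \<and> quad (pole j) (w (j - 1)) (w j) (w (j + 1)) (H j ` X) \<and>
    side \<sigma> (H j ` X) (pole j) (w (j - 1)) \<and>
    corner_number \<sigma> (w (j - 1)) (w j) (w (j + 1)) = (if T j then zA else zD) \<and>
    corner_number \<sigma> (w j) (w (j + 1)) (pole j) =
      (if even j then if T j then zD else zA else if T j then zB else zC) \<and>
    corner_number \<sigma> (pole j) (w (j - 1)) (w j) =
      (if even j then if T j then zB else zC else if T j then zD else zA))"

lemmas tile = someI_ex[OF oriented_tile, folded \<sigma>_def]

lemma tile_quad: "quad (pole j) (w (j - 1)) (w j) (w (j + 1)) (H j ` X)"
  using tile[of j] by blast

lemma \<sigma>: "\<sigma> j = 1 \<or> \<sigma> j = -1" "\<sigma> j \<noteq> 0"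
  using tile[of j] by auto

lemma tile_closure: "closure (H j ` X) = K j"
  using closure_injective_linear_image[OF orthogonal_transformation_linear orthogonal_transformation_inj, OF HT(1) HT(1)]
    HT(2) by metis

lemma tiles_disjoint:
  assumes "d \<in> {1, 2, -1, -2}"
  shows "H j ` X \<inter> H (j + d) ` X = {}"
proof -
  have "x \<in> K i" if "x \<in> H i ` X" for x i
    using subsetD[OF closure_subset that] tile_closure by simp
  then have "H j ` X \<inter> H (j + d) ` X \<subseteq> quad_bd (pole j) (w (j - 1)) (w j) (w (j + 1))"
    using overlap[OF assms, of j] by (meson IntD1 IntD2 IntI subset_iff)
  then show ?thesis using quad.disjoint_bd[OF tile_quad[of j]] by blast
qed

lemma tile_sides:
  "side (\<sigma> j) (H j ` X) (pole j) (w (j - 1))"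
  "side (\<sigma> j) (H j ` X) (w (j - 1)) (w j)"
  "side (\<sigma> j) (H j ` X) (w j) (w (j + 1))"
  using quad.side_cycle[OF tile_quad[of j] \<sigma>(2)] tile[of j] by blast+

lemma tile_corners:
  "corner_at (\<sigma> j) (H j ` X) (pole j) (w (j - 1)) (w j)"
  "corner_at (\<sigma> j) (H j ` X) (w (j - 1)) (w j) (w (j + 1))"
  "corner_at (\<sigma> j) (H j ` X) (w j) (w (j + 1)) (pole j)"
  using quad.corner_iff[OF tile_quad[of j] \<sigma>(2)] tile_sides by blast+

text \<open>Both tiles traverse their common edge from \<open>w j\<close> to
  \<open>w (j + 1)\<close>. With equal signs they would contain overlapping half caps along
  it.\<close>

lemma orientation_alternates: "\<sigma> (j + 1) = - \<sigma> j"
proof (rule ccontr)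
  assume "\<not> ?thesis"
  then have eq: "\<sigma> (j + 1) = \<sigma> j" using \<sigma>(1)[of j] \<sigma>(1)[of "j + 1"] by auto
  let ?p = "w j" and ?q = "w (j + 1)"
  interpret Q: quad "pole j" "w (j - 1)" "w j" "w (j + 1)" "H j ` X" by (rule tile_quad)
  interpret Q': quad "pole (j + 1)" "w j" "w (j + 1)" "w (j + 1 + 1)" "H (j + 1) ` X"
    using tile_quad[of "j + 1"] by simp
  obtain y where y: "y \<in> oarc ?p ?q" using oarc_nonempty Q.unit Q.not_antipodal by metis
  have "edge_at (\<sigma> j) (H j ` X) ?p ?q y"
    using corner.side_iff_edge[OF Q.corner_CDA \<sigma>(2) y] tile_sides(3) by blast
  moreover have "edge_at (\<sigma> j) (H (j + 1) ` X) ?p ?q y"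
    using corner.side_iff_edge[OF Q'.corner_BCD \<sigma>(2) y] tile_sides(2)[of "j + 1"] eq by simp
  ultimately obtain a b where *: "a < 1" "half_cap (\<sigma> j) ?p ?q y a \<subseteq> H j ` X"
      "b < 1" "half_cap (\<sigma> j) ?p ?q y b \<subseteq> H (j + 1) ` X"
    by (auto simp: edge_at_def)
  have y': "norm y = 1" "tp ?p ?q y = 0" using y tp_oarc by (auto simp: oarc_def)
  then have "a < y \<bullet> y" using * by (simp add: norm_eq_1)
  then obtain x where "x \<in> half_cap (\<sigma> j) ?p ?q y a" "x \<in> half_cap (\<sigma> j) ?p ?q y b"
    using half_caps_meet[OF y' Q.cross_nz(3) \<sigma>(2)] * by metis
  then show False using * tiles_disjoint[of 1 j] by auto
qed

text \<open>The corners of tiles \<open>j - 1\<close>, \<open>j\<close>, \<open>j + 1\<close> at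
  \<open>w j\<close> form a cycle, so \<open>corner_number_product\<close> applies; tile
  \<open>j\<close> has the opposite sign and is traversed in reverse. Tile \<open>partner j\<close>
  has there the end of its \<open>b\<close>-edge away from \<open>w (partner j)\<close>, and tile
  \<open>other j\<close> has \<open>B\<close> or \<open>C\<close>.\<close>

lemma vertex_relation:
  "\<exists>r>0. (if T j then zA else zD) * (if T (partner j) then zD else zA) * (if T (other j) then zB else zC) = of_real r"
proof -
  let ?t = "\<sigma> (j + 1)" and ?p = "pole (j + 1)"
  have t: "\<sigma> (j - 1) = ?t" "\<sigma> j = - ?t" "pole (j - 1) = ?p"
    using orientation_alternates[of j] orientation_alternates[of "j - 1"] pole[of "j - 1"] by (simp_all add: add.commute)
  interpret Q: quad "pole j" "w (j - 1)" "w j" "w (j + 1)" "H j ` X" by (rule tile_quad)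
  interpret Q': quad "pole (j + 1)" "w j" "w (j + 1)" "w (j + 1 + 1)" "H (j + 1) ` X"
    using tile_quad[of "j + 1"] by simp
  have "corner_number ?t (w (j - 1)) (w j) ?p * corner_number ?t ?p (w j) (w (j + 1)) *
      corner_number ?t (w (j + 1)) (w j) (w (j - 1)) =
    of_real ((norm (cross3 (w (j - 1)) (w j)))\<^sup>2 * (norm (cross3 ?p (w j)))\<^sup>2 * (norm (cross3 (w (j + 1)) (w j)))\<^sup>2)"
    (is "_ = of_real ?r") by (rule corner_number_product[OF Q.unit(3) \<sigma>(1)])
  moreover have "?r > 0"
    using Q.cross_nz Q'.cross_nz cross_skew[of "w (j + 1)" "w j"] by simp
  moreover have "corner_number ?t (w (j + 1)) (w j) (w (j - 1)) = (if T j then zA else zD)"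
    using tile[of j] corner_number_reverse[of "?t" "w (j - 1)" "w j" "w (j + 1)"] corner_number_reverse[of "- ?t" "w (j + 1)" "w j" "w (j - 1)"] t by simp
  moreover have "corner_number ?t (w (j - 1)) (w j) ?p = (if even j then if T (j - 1) then zB else zC else if T (j - 1) then zD else zA)"
    using tile[of "j - 1"] t by simp
  moreover have "corner_number ?t ?p (w j) (w (j + 1)) = (if even j then if T (j + 1) then zD else zA else if T (j + 1) then zB else zC)"
    using tile[of "j + 1"] by simp
  ultimately show ?thesis
    by (intro exI[of _ ?r] conjI; cases "even j")
      (simp_all add: partner_def other_def mult_ac split del: if_split)
qed

text \<open>Different types put the same label on both sides of the \<open>b\<close>-edge at
  \<open>w j\<close>, and two concave corners there would overlap.\<close>

lemma mirrored_not_concave: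
  assumes "T j \<noteq> T (partner j)"
  shows "0 \<le> Im (if T j then zA else zD)"
proof (rule ccontr)
  assume neg: "\<not> ?thesis"
  show False
  proof (cases "even j")
    case True
    let ?v = "w j" and ?w = "w (j + 1)"
    have \<sigma>': "\<sigma> (j + 1) = - \<sigma> j" by (rule orientation_alternates)
    have c: "corner_at (- \<sigma> j) (H j ` X) ?w ?v (w (j - 1))"
      using tile_corners(2)[of j] by (simp add: corner_at_reverse)
    have c': "corner_at (\<sigma> j) (H (j + 1) ` X) ?w ?v (pole (j + 1))"
      using tile_corners(1)[of "j + 1"] \<sigma>' corner_at_reverse[of "- \<sigma> j" _ ?w ?v "pole (j + 1)"] by simp
    have "corner_number (- \<sigma> j) ?w ?v (w (j - 1)) = (if T j then zA else zD)"
      using tile[of j] by (simp add: corner_number_reverse)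
    then have 1: "- \<sigma> j * tp ?w ?v (w (j - 1)) < 0"
      using neg by (simp only: not_le Im_corner_number)
    have "corner_number (\<sigma> j) ?w ?v (pole (j + 1)) = (if T j then zA else zD)"
      using tile[of "j + 1"] \<sigma>' True assms corner_number_reverse[of "\<sigma> j" "pole (j + 1)" ?v ?w]
      by (auto simp: partner_def)
    then have 2: "\<sigma> j * tp ?w ?v (pole (j + 1)) < 0"
      using neg by (simp only: not_le Im_corner_number)
    show False
      using concave_corners_overlap[of ?v "- \<sigma> j" "H j ` X" ?w "w (j - 1)" "H (j + 1) ` X" "pole (j + 1)"]
        c c' 1 2 quad.unit(3)[OF tile_quad[of j]] tiles_disjoint[of 1 j] by simp
  next
    case False
    let ?v = "w j" and ?w = "w (j - 1)"
    have \<sigma>': "\<sigma> (j - 1) = - \<sigma> j" using orientation_alternates[of "j - 1"] by simp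
    have c: "corner_at (\<sigma> j) (H j ` X) ?w ?v (w (j + 1))"
      using tile_corners(2)[of j] by simp
    have c': "corner_at (- \<sigma> j) (H (j - 1) ` X) ?w ?v (pole (j - 1))"
      using tile_corners(3)[of "j - 1"] \<sigma>' by simp
    have "corner_number (\<sigma> j) ?w ?v (w (j + 1)) = (if T j then zA else zD)"
      using tile[of j] by simp
    then have 1: "\<sigma> j * tp ?w ?v (w (j + 1)) < 0"
      using neg by (simp only: not_le Im_corner_number)
    have "corner_number (- \<sigma> j) ?w ?v (pole (j - 1)) = (if T j then zA else zD)"
      using tile[of "j - 1"] \<sigma>' False assms by (auto simp: partner_def)
    then have 2: "- \<sigma> j * tp ?w ?v (pole (j - 1)) < 0"
      using neg by (simp only: not_le Im_corner_number)
    show False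
      using concave_corners_overlap[of ?v "\<sigma> j" "H j ` X" ?w "w (j + 1)" "H (j - 1) ` X" "pole (j - 1)"]
        c c' 1 2 quad.unit(3)[OF tile_quad[of j]] tiles_disjoint[of 1 "j - 1"] by auto
  qed
qed

end

lemma partner_partner [simp]: "partner (partner j) = j"
  by (simp add: partner_def)

lemma other_other [simp]: "other (other j) = j"
  by (simp add: other_def)

context quad
begin

text \<open>A number equal to its modulus would be a zero angle.\<close>

lemma corner_number_not_pos:
  assumes "s = 1 \<or> s = -1"
  shows "Re (corner_number s A B C) \<noteq> cmod (corner_number s A B C)"
  using wedge_nondegenerate[of A B C] unit not_antipodal cross_nz adjacent assms
  by (simp add: Re_corner_number norm_corner_number)

lemma norm_corner_number_lengths:
  assumes "s = 1 \<or> s = -1"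
  shows "(cmod (corner_number s A B C))\<^sup>2 = (1 - (A \<bullet> B)\<^sup>2) * (1 - (B \<bullet> C)\<^sup>2)"
proof -
  have "(norm (cross3 A B))\<^sup>2 = 1 - (A \<bullet> B)\<^sup>2" "(norm (cross3 C B))\<^sup>2 = 1 - (B \<bullet> C)\<^sup>2"
    using norm_cross_dot[of A B] norm_cross_dot[of C B] unit by (simp_all add: inner_commute)
  then show ?thesis using unit assms by (simp add: norm_corner_number power_mult_distrib)
qed

end

text \<open>Positivity gives \<open>z\<^sup>2\<close> the direction of \<open>cnj z'\<close>;
  knowing the moduli turns this into an equation.\<close>

lemma positive_multiple:
  fixes z z' :: complex
  assumes "z\<^sup>2 * z' = of_real r" "r > 0" "(cmod z)\<^sup>2 = n" "cmod z' = m" "m > 0"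
  shows "of_real m * z\<^sup>2 = of_real n * cnj z'"
proof -
  have "cmod (z\<^sup>2 * z') = r" using assms by simp
  moreover have "cmod (z\<^sup>2 * z') = (cmod z)\<^sup>2 * cmod z'" by (simp add: norm_mult norm_power)
  ultimately have r: "r = n * m" using assms(3,4) by simp
  have "z\<^sup>2 * (z' * cnj z') = of_real (n * m) * cnj z'"
    using assms(1) r by (metis mult.assoc)
  then have "of_real m * (of_real m * z\<^sup>2) = of_real m * (of_real n * cnj z')"
    using assms(4) by (simp add: complex_norm_square[symmetric] power2_eq_square mult_ac)
  then show ?thesis using assms(5) by simp
qed

section \<open>Comparing the types of the tiles\<close>

context tiled_wheel
begin

lemmas corner_numbers = zA_def zB_def zC_def zD_def

lemma not_mirrored:
  assumes "c = k" "A \<bullet> C \<noteq> B \<bullet> D"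
  shows "T (partner j) = T j"
proof (rule ccontr)
  assume "\<not> ?thesis"
  \<comment> \<open>Tiles \<open>i\<close> and \<open>partner i\<close> both have \<open>D\<close>
    at \<open>w i\<close>, and both have \<open>A\<close> at the other end of their common
    \<open>b\<close>-edge.\<close>
  then obtain i where i: "\<not> T i" "T (partner i)" by (metis partner_partner)
  define P R where "P = A \<bullet> C" and "R = B \<bullet> D"
  have PR: "P \<noteq> R" using assms by (simp add: P_def R_def)
  have len: "A \<bullet> B = k" "B \<bullet> C = k" "C \<bullet> D = k" "D \<bullet> A = l" using lengths assms by auto
  define m n where "m = 1 - k\<^sup>2" and "n = (1 - k\<^sup>2) * (1 - l\<^sup>2)"
  have "(norm (cross3 A B))\<^sup>2 = m"
    using norm_cross_dot[of A B] unit len by (simp add: m_def)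
  then have m: "m > 0" using cross_nz(1) by (metis zero_less_norm_iff zero_less_power)
  have "(norm (cross3 D A))\<^sup>2 = 1 - l\<^sup>2"
    using norm_cross_dot[of D A] unit len by simp
  then have n: "n > 0" using cross_nz(4) m by (metis m_def n_def mult_pos_pos zero_less_norm_iff zero_less_power)
  note q = quad_axioms rotate quad.rotate[OF rotate] quad.rotate[OF quad.rotate[OF rotate]]
  have "(cmod zB)\<^sup>2 = m\<^sup>2" "(cmod zC)\<^sup>2 = m\<^sup>2"
    using q[THEN quad.norm_corner_number_lengths, OF s(1)] len by (simp_all add: corner_numbers m_def power2_eq_square)
  then have norm_BC: "cmod zB = m" "cmod zC = m" using m by simp_all
  have norm_AD: "(cmod zA)\<^sup>2 = n" "(cmod zD)\<^sup>2 = n"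
    using q[THEN quad.norm_corner_number_lengths, OF s(1)] len by (simp_all add: corner_numbers n_def mult.commute)
  have Re: "Re zA = R - l * k" "Re zD = P - k * l" "Re zB = P - k * k" "Re zC = R - k * k"
    using len by (simp_all add: corner_numbers corner_number_def P_def R_def inner_commute)
  obtain r where D: "zD\<^sup>2 * (if T (other i) then zB else zC) = of_real r" "r > 0"
    using vertex_relation[of i] i by (auto simp: power2_eq_square split del: if_split)
  obtain r' where A: "zA\<^sup>2 * (if T (other (partner i)) then zB else zC) = of_real r'" "r' > 0"
    using vertex_relation[of "partner i"] i by (auto simp: power2_eq_square split del: if_split)
  define zX zY where "zX = (if T (other i) then zB else zC)" and "zY = (if T (other (partner i)) then zB else zC)"
  have "cmod zX = m" "cmod zY = m" using norm_BC by (simp_all add: zX_def zY_def)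
  then have D': "of_real m * zD\<^sup>2 = of_real n * cnj zX" and A': "of_real m * zA\<^sup>2 = of_real n * cnj zY"
    using positive_multiple[OF D[folded zX_def] norm_AD(2) _ m] positive_multiple[OF A[folded zY_def] norm_AD(1) _ m]
    by simp_all
  show False
  proof (cases "zX = zY")
    case True
    then have "zA\<^sup>2 = zD\<^sup>2" using A' D' m by (metis mult_cancel_left of_real_eq_0_iff less_irrefl)
    then have "zA = zD \<or> zA = - zD" by (simp add: power2_eq_iff)
    then show False
    proof
      assume "zA = zD"
      then have "Re zA = Re zD" by simp
      then show False using Re PR by (simp add: mult.commute)
    next
      assume opp: "zA = - zD"
      \<comment> \<open>Opposite numbers with nonnegative imaginary parts are real, so one of them
        equals its modulus, a zero angle.\<close>
      have "Im zD \<ge> 0" "Im zA \<ge> 0"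
        using mirrored_not_concave[of i] mirrored_not_concave[of "partner i"] i by auto
      then have 0: "Im zA = 0" "Im zD = 0" using opp by simp_all
      then have "cmod zA = \<bar>Re zA\<bar>" "cmod zD = \<bar>Re zD\<bar>" by (simp_all add: cmod_def)
      moreover have "Re zA = - Re zD" using opp by simp
      ultimately have "Re zA = cmod zA \<or> Re zD = cmod zD" by linarith
      then show False
        using q[THEN quad.corner_number_not_pos, OF s(1)] by (auto simp: corner_numbers)
    qed
  next
    case False
    have "P \<noteq> 1" "R \<noteq> 1"
    proof -
      have "P = 1 \<Longrightarrow> (A - C) \<bullet> (A - C) = 0" "R = 1 \<Longrightarrow> (B - D) \<bullet> (B - D) = 0"
        using unit by (simp_all add: P_def R_def inner_simps inner_commute norm_eq_1)
      then show "P \<noteq> 1" "R \<noteq> 1" using distinct by auto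
    qed
    have id: "(1 - P) * (m * n - Re (zA\<^sup>2 * cnj zC)) = (1 - R) * (m * n - Re (zD\<^sup>2 * cnj zB))"
      using three_equal_sides_identity[OF unit s(1) len refl refl]
      by (simp add: corner_numbers P_def R_def m_def n_def power2_eq_square mult_ac)
    have mRe: "m * Re (z\<^sup>2 * cnj w) = n * Re (cnj w' * cnj w)"
      if "of_real m * z\<^sup>2 = of_real n * cnj w'" for z w w'
    proof -
      have "of_real m * (z\<^sup>2 * cnj w) = of_real n * (cnj w' * cnj w)"
        using that by (metis mult.assoc)
      then have "Re (of_real m * (z\<^sup>2 * cnj w)) = Re (of_real n * (cnj w' * cnj w))" by (rule arg_cong)
      moreover have "Re (of_real x * u) = x * Re u" for x u by simp
      ultimately show ?thesis by (simp only:)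
    qed
    have id': "(1 - P) * (m * (m * n) - m * Re (zA\<^sup>2 * cnj zC)) = (1 - R) * (m * (m * n) - m * Re (zD\<^sup>2 * cnj zB))"
      using arg_cong[OF id, of "\<lambda>x. m * x"] by (simp add: algebra_simps)
    have sq: "Re (cnj w * cnj w) = 2 * (Re w)\<^sup>2 - m\<^sup>2" if "cmod w = m" for w
      using that cmod_power2[of w] by (simp add: power2_eq_square)
    consider "zX = zB" "zY = zC" | "zX = zC" "zY = zB"
      using False by (auto simp: zX_def zY_def split: if_splits)
    then show False
    proof cases
      case 1
      have "(1 - P) * (m * (m * n) - n * (2 * (Re zC)\<^sup>2 - m\<^sup>2)) = (1 - R) * (m * (m * n) - n * (2 * (Re zB)\<^sup>2 - m\<^sup>2))"
        using id' mRe[OF A', of zC] mRe[OF D', of zB] sq[OF norm_BC(1)] sq[OF norm_BC(2)] 1 by simp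
      then have "2 * n * ((1 - P) * ((m - Re zC) * (m + Re zC))) = 2 * n * ((1 - R) * ((m - Re zB) * (m + Re zB)))"
        by (simp add: power2_eq_square algebra_simps)
      \<comment> \<open>Since \<open>m - Re zC = 1 - R\<close> and \<open>m - Re zB = 1 - P\<close>,
        the factor \<open>(1 - P) * (1 - R)\<close> appears on both sides.\<close>
      then have "(1 - P) * ((1 - R) * (m + Re zC)) = (1 - R) * ((1 - P) * (m + Re zB))"
        using n by (simp add: Re m_def power2_eq_square)
      then have "Re zC = Re zB" using \<open>P \<noteq> 1\<close> \<open>R \<noteq> 1\<close> by simp
      then show False using Re PR by simp
    next
      case 2
      \<comment> \<open>The brackets on the two sides now coincide, so \<open>P \<noteq> R\<close>
        makes the bracket vanish.\<close>
      have "(1 - P) * (m * (m * n) - n * Re (zB * zC)) = (1 - R) * (m * (m * n) - n * Re (zB * zC))"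
        using id' mRe[OF A', of zC] mRe[OF D', of zB] 2 by (simp add: mult.commute)
      then have "m * (m * n) - n * Re (zB * zC) = 0" using PR by simp
      then have "n * (m * m - Re (zB * zC)) = 0" by (simp add: algebra_simps)
      then have "Re (zB * zC) = m\<^sup>2" using n by (simp add: power2_eq_square)
      moreover have "(Re zB)\<^sup>2 + (Im zB)\<^sup>2 = m\<^sup>2" "(Re zC)\<^sup>2 + (Im zC)\<^sup>2 = m\<^sup>2"
        using norm_BC cmod_power2[of zB] cmod_power2[of zC] by simp_all
      \<comment> \<open>Both moduli being \<open>m\<close>, this is the equality case in which
        \<open>zB\<close> is the conjugate of \<open>zC\<close>.\<close>
      ultimately have "(Re zB - Re zC)\<^sup>2 + (Im zB + Im zC)\<^sup>2 = 0"
        by (simp add: power2_eq_square algebra_simps)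
      then have "Re zB = Re zC" by (simp add: sum_power2_eq_zero_iff)
      then show False using Re PR by simp
    qed
  qed
qed

text \<open>Once types agree across \<open>b\<close>-edges, the relation at a vertex involves
  \<open>zA * zD\<close> and a third factor showing the type. If both types occurred,
  \<open>zB\<close> and \<open>zC\<close>, of equal modulus, would coincide.\<close>

lemma type_constant:
  assumes "c = k" "A \<bullet> C \<noteq> B \<bullet> D"
  shows "T i = T j"
proof -
  \<comment> \<open>The vertex \<open>w (other j)\<close> is the one where tile \<open>j\<close> has
    its corner \<open>B\<close> or \<open>C\<close>.\<close>
  have rel: "\<exists>r>0. zA * zD * (if T j then zB else zC) = of_real r" for j
    using vertex_relation[of "other j"] not_mirrored[OF assms, of "other j"]
    by (auto simp: mult_ac split: if_splits)
  {
    fix i j assume ij: "T i" "\<not> T j"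
    obtain r r' where r: "r > 0" "zA * zD * zB = of_real r" "r' > 0" "zA * zD * zC = of_real r'"
      using rel[of i] rel[of j] ij by auto
    note q = quad_axioms rotate
    have "(cmod zB)\<^sup>2 = (cmod zC)\<^sup>2"
      using q[THEN quad.norm_corner_number_lengths, OF s(1)] lengths assms by (simp add: corner_numbers)
    then have "cmod zB = cmod zC" by simp
    moreover have "r = cmod (zA * zD * zB)" "r' = cmod (zA * zD * zC)" using r by simp_all
    ultimately have "r = r'" by (simp add: norm_mult)
    then have "zA * zD * zB = zA * zD * zC" "zA * zD \<noteq> 0" using r by auto
    then have "Re zB = Re zC" by simp
    then have False using lengths assms by (simp add: corner_numbers corner_number_def inner_commute)
  }
  then show ?thesis by blast
qed

lemma meridian_length: "pole j \<bullet> w (other j) = k"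
proof -
  have "H j B \<bullet> H j C = k" using lengths orthogonal_inner[OF HT(1)] by simp
  then show ?thesis using HT(3)[of j] by (auto simp: inner_commute split: if_splits)
qed

text \<open>For type \<open>T j\<close> the meridian edge to \<open>w (partner j)\<close> is an edge
  \<open>CD\<close>, but in the tile across that meridian it is an edge \<open>BC\<close>.\<close>

lemma type_of_distinct_lengths:
  assumes "c \<noteq> k"
  shows "\<not> T j"
proof
  assume "T j"
  then have "pole j \<bullet> w (partner j) = H j C \<bullet> H j D" using HT(3)[of j] by simp
  also have "\<dots> = c" using lengths orthogonal_inner[OF HT(1)] by simp
  finally have "pole j \<bullet> w (partner j) = c" .
  moreover have "pole (other (partner j)) = pole j"
    using pole[of j] pole[of "j - 2"] by (auto simp: other_def partner_def add.commute)
  ultimately show False using meridian_length[of "other (partner j)"] assms by simp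
qed

end

section \<open>Symmetries of the prototile\<close>

lemma isometric_self_map_surj:
  fixes g :: "'a::heine_borel \<Rightarrow> 'a"
  assumes "compact S" "g ` S \<subseteq> S" "\<And>x y. x \<in> S \<Longrightarrow> y \<in> S \<Longrightarrow> dist (g x) (g y) = dist x y"
  shows "g ` S = S"
proof (rule ccontr)
  assume "g ` S \<noteq> S"
  then obtain x where x: "x \<in> S" "x \<notin> g ` S" using assms by blast
  have iso: "continuous_on S g" unfolding continuous_on_iff using assms(3) by metis
  then have "closed (g ` S)" using assms(1) compact_continuous_image compact_imp_closed by blast
  then obtain d where d: "d > 0" "\<And>y. y \<in> g ` S \<Longrightarrow> d \<le> dist x y"
    using separate_point_closed[of "g ` S" x] x by metis
  have orb: "(g ^^ n) x \<in> S" for n by (induction n) (use x assms in auto)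
  \<comment> \<open>The missed point has distance at least \<open>d\<close> from the image; the
    isometry carries this along the orbit, leaving no Cauchy subsequence.\<close>
  have sep: "d \<le> dist ((g ^^ i) x) ((g ^^ (i + Suc n)) x)" for i n
  proof (induction i)
    case 0
    then show ?case using d orb[of n] by simp
  next
    case (Suc i)
    then show ?case using assms(3)[OF orb[of i] orb[of "i + Suc n"]] by simp
  qed
  obtain a r where a: "strict_mono r" "((\<lambda>n. (g ^^ n) x) \<circ> r) \<longlonglongrightarrow> a"
    using assms(1) orb unfolding compact_def by metis
  then have "Cauchy ((\<lambda>n. (g ^^ n) x) \<circ> r)" by (intro LIMSEQ_imp_Cauchy)
  then obtain N where N: "\<And>m n. m \<ge> N \<Longrightarrow> n \<ge> N \<Longrightarrow> dist ((g ^^ r m) x) ((g ^^ r n) x) < d"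
    using d unfolding Cauchy_def by (metis comp_apply)
  have "r N < r (Suc N)" using a strict_monoD by blast
  then obtain n where "r (Suc N) = r N + Suc n" by (metis add_Suc_right less_imp_Suc_add)
  then show False using N[of N "Suc N"] sep[of "r N" n] by simp
qed

text \<open>This is the reflection in the plane perpendicular to \<open>a\<close>; for
  \<open>a = 0\<close> it degenerates to the identity.\<close>

lemma reflection_orthogonal:
  fixes a :: "'a::real_inner"
  shows "orthogonal_transformation (\<lambda>x. x - (2 * (x \<bullet> a) / (a \<bullet> a)) *\<^sub>R a)"
  unfolding orthogonal_transformation_def
proof (intro conjI allI)
  show "linear (\<lambda>x. x - (2 * (x \<bullet> a) / (a \<bullet> a)) *\<^sub>R a)"
    by (rule linearI) (simp_all add: inner_simps algebra_simps add_divide_distrib)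
  fix x y
  show "(x - (2 * (x \<bullet> a) / (a \<bullet> a)) *\<^sub>R a) \<bullet> (y - (2 * (y \<bullet> a) / (a \<bullet> a)) *\<^sub>R a) = x \<bullet> y"
    by (cases "a = 0") (simp_all add: inner_simps inner_commute field_simps)
qed

lemma orthogonal_transformation_minus:
  assumes "orthogonal_transformation h"
  shows "orthogonal_transformation (\<lambda>x. - h x)"
  using assms by (simp add: orthogonal_transformation_def linear_compose_neg)

text \<open>Terms of the trilinear expansion containing \<open>a\<close> twice vanish; the other
  corrections add up to twice the triple product.\<close>

lemma tp_reflection:
  fixes a :: "real^3"
  assumes "a \<noteq> 0"
  defines "h \<equiv> \<lambda>x. x - (2 * (x \<bullet> a) / (a \<bullet> a)) *\<^sub>R a"
  shows "tp (h p) (h q) (h x) = - tp p q x"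
proof -
  have "tp (p - r *\<^sub>R a) (q - s *\<^sub>R a) (x - t *\<^sub>R a) =
      tp p q x - r * tp a q x - s * tp p a x - t * tp p q a" for r s t
    by (simp add: tp_coords algebra_simps)
  moreover have "(p \<bullet> a) * tp a q x + (q \<bullet> a) * tp p a x + (x \<bullet> a) * tp p q a = (a \<bullet> a) * tp p q x"
    by (simp add: tp_coords inner_vec_def sum_3) algebra
  moreover have "tp (h p) (h q) (h x) = tp p q x
      - (2 / (a \<bullet> a)) * ((p \<bullet> a) * tp a q x + (q \<bullet> a) * tp p a x + (x \<bullet> a) * tp p q a)"
    unfolding h_def calculation(1) by (simp add: algebra_simps)
  ultimately show ?thesis
    using assms(1) by simp
qed

text \<open>The two symmetries exchanging \<open>A\<close> with \<open>D\<close> and \<open>B\<close> with \<open>C\<close>: if \<open>A - D\<close> and \<open>B - C\<close> are parallel this is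
  the reflection in their common perpendicular plane, otherwise the half-turn about their common
  perpendicular, which contains \<open>A + D\<close> and \<open>B + C\<close>.\<close>
lemma exchanging_symmetry:
  fixes A B C D :: "real^3"
  assumes "norm A = 1" "norm B = 1" "norm C = 1" "norm D = 1" "A \<noteq> D" "B \<noteq> C"
    and "A \<bullet> B = C \<bullet> D" "A \<bullet> C = B \<bullet> D"
  obtains h e where "orthogonal_map h e" "h A = D" "h B = C" "h C = B" "h D = A"
proof -
  define u v p q where "u = A + D" and "v = B + C" and "p = A - D" and "q = B - C"
  have orth: "u \<bullet> p = 0" "v \<bullet> q = 0" "u \<bullet> q = 0" "v \<bullet> p = 0"
    using assms by (simp_all add: u_def v_def p_def q_def inner_simps norm_eq_1 inner_commute)
  have nz: "p \<noteq> 0" "q \<noteq> 0" using assms by (simp_all add: p_def q_def)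
  \<comment> \<open>Hence a linear map that fixes \<open>u\<close>, \<open>v\<close> and negates
    \<open>p\<close>, \<open>q\<close> makes the required exchange.\<close>
  have pts: "A = (1/2) *\<^sub>R (u + p)" "D = (1/2) *\<^sub>R (u - p)" "B = (1/2) *\<^sub>R (v + q)" "C = (1/2) *\<^sub>R (v - q)"
    by (simp_all add: u_def v_def p_def q_def scaleR_add_right scaleR_diff_right flip: scaleR_add_left)
  show thesis
  proof (cases "cross3 p q = 0")
    case True
    define h where "h = (\<lambda>x. x - (2 * (x \<bullet> p) / (p \<bullet> p)) *\<^sub>R p)"
    have h: "orthogonal_transformation h" unfolding h_def by (rule reflection_orthogonal)
    then have lin: "linear h" by (rule orthogonal_transformation_linear)
    have "h u = u" "h v = v" "h p = - p" using orth nz by (simp_all add: h_def scaleR_2)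
    moreover have "h q = - q"
    proof -
      obtain r where "q = r *\<^sub>R p" using True nz unfolding cross_eq_0 collinear_lemma by auto
      then show ?thesis using \<open>h p = - p\<close> lin by (simp add: linear_cmul)
    qed
    ultimately have "h A = D" "h B = C" "h C = B" "h D = A"
      by (simp_all only: pts linear_cmul[OF lin] linear_add[OF lin] linear_diff[OF lin]) simp_all
    moreover have "orthogonal_map h (-1)"
      using h tp_reflection[OF nz(1)] by unfold_locales (simp_all add: h_def)
    ultimately show ?thesis using that by blast
  next
    case False
    define a where "a = cross3 p q"
    define g where "g = (\<lambda>x. x - (2 * (x \<bullet> a) / (a \<bullet> a)) *\<^sub>R a)"
    \<comment> \<open>Minus the reflection along \<open>a\<close> is the half-turn about
      \<open>a\<close>; vectors perpendicular to \<open>p\<close> and \<open>q\<close> lie on this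
      axis.\<close>
    define h where "h = (\<lambda>x. - g x)"
    have g: "orthogonal_transformation g" unfolding g_def by (rule reflection_orthogonal)
    then have h: "orthogonal_transformation h" unfolding h_def by (rule orthogonal_transformation_minus)
    then have lin: "linear h" by (rule orthogonal_transformation_linear)
    have "h p = - p" "h q = - q"
      by (simp_all add: h_def g_def a_def dot_cross_self)
    moreover have fix_perp: "h x = x" if "x \<bullet> p = 0" "x \<bullet> q = 0" for x
    proof -
      have "cross3 x a = 0"
        using that by (simp add: a_def Lagrange)
      then have "cross3 a x = 0" using cross_skew[of a x] by simp
      then obtain r where "x = r *\<^sub>R a"
        using False unfolding cross_eq_0 collinear_lemma a_def by (metis scale_zero_left)
      moreover have "2 * (x \<bullet> a) / (a \<bullet> a) = 2 * r"
        using False \<open>x = r *\<^sub>R a\<close> by (simp add: a_def)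
      ultimately have "h x = (2 * r - r) *\<^sub>R a"
        by (simp only: h_def g_def scaleR_left_diff_distrib) simp
      then show ?thesis using \<open>x = r *\<^sub>R a\<close> by simp
    qed
    then have "h u = u" "h v = v" using orth by (simp_all add: inner_commute)
    ultimately have "h A = D" "h B = C" "h C = B" "h D = A"
      by (simp_all only: pts linear_cmul[OF lin] linear_add[OF lin] linear_diff[OF lin]) simp_all
    moreover obtain e where "orthogonal_map h e" using orthogonal_map_exists[OF h] by metis
    ultimately show ?thesis using that by blast
  qed
qed

context quad
begin

text \<open>Both components contain half caps at one point of the arc, and these meet.\<close>

lemma same_side_eq:
  assumes "quad A B C D Z" "s \<noteq> 0" "side s X A B" "side s Z A B"
  shows "Z = X"
proof -
  interpret Z: quad A B C D Z by fact
  obtain y where y: "y \<in> oarc A B" using assms(3) by (auto simp: side_def)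
  have "edge_at s X A B y" "edge_at s Z A B y"
    using corner.side_iff_edge[OF corner_ABC assms(2) y] corner.side_iff_edge[OF Z.corner_ABC assms(2) y] assms
    by blast+
  then obtain a b where *: "a < 1" "half_cap s A B y a \<subseteq> X" "b < 1" "half_cap s A B y b \<subseteq> Z"
    by (auto simp: edge_at_def)
  have y': "norm y = 1" "tp A B y = 0" using y tp_oarc by (auto simp: oarc_def)
  then have "a < y \<bullet> y" using * by (simp add: norm_eq_1)
  then obtain x where "x \<in> half_cap s A B y a" "x \<in> half_cap s A B y b"
    using half_caps_meet[OF y' cross_nz(1) assms(2)] * by metis
  then have "x \<in> X \<inter> Z" using * by blast
  then show ?thesis using components_nonoverlap[OF component Z.component] by blast
qed

text \<open>Points of the open arc are limits of the half caps given by \<open>some_side\<close>,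
  and the end points are limits of the open arc.\<close>

lemma garc_in_closure: "garc A B \<subseteq> closure X"
proof -
  obtain s where s: "s \<noteq> 0" "side s X A B" using some_side by (metis neg_equal_0_iff_equal zero_neq_one)
  have o: "y \<in> closure X" if y: "y \<in> oarc A B" for y
    unfolding closure_iff_nhds_not_empty
  proof clarify
    fix U V assume U: "V \<subseteq> U" "open V" "y \<in> V" "X \<inter> U = {}"
    have "edge_at s X A B y" using corner.side_iff_edge[OF corner_ABC s(1) y] s by blast
    then obtain a where a: "a < 1" "half_cap s A B y a \<subseteq> X" by (auto simp: edge_at_def)
    have y': "norm y = 1" "tp A B y = 0" using y tp_oarc by (auto simp: oarc_def)
    have "open (V \<inter> {x. a < x \<bullet> y})" "y \<in> V \<inter> {x. a < x \<bullet> y}"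
      using U a y' by (auto simp: norm_eq_1 intro!: open_Int open_cap)
    then obtain x where "x \<in> V \<inter> {x. a < x \<bullet> y}" "norm x = 1" "0 < s * tp A B x"
      using half_side_approach[OF y' cross_nz(1) s(1)] by metis
    then have "x \<in> X \<inter> U" using U a by (auto simp: half_cap_def)
    then show False using U by blast
  qed
  have "v \<in> closure X" if "v = A \<or> v = B" for v
  proof -
    have "v \<in> closure (closure X)"
      unfolding closure_iff_nhds_not_empty[of v "closure X"]
    proof clarify
      fix U V assume U: "V \<subseteq> U" "open V" "v \<in> V" "closure X \<inter> U = {}"
      have "\<exists>y \<in> V. y \<in> oarc A B"
        using that
      proof
        assume "v = A"
        then show ?thesis
          using oarc_near_end[of B A V] unit U unfolding oarc_commute[of A B] by blast
      next
        assume "v = B"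
        then show ?thesis using oarc_near_end[of A B V] unit U by blast
      qed
      then show False using o U by blast
    qed
    then show ?thesis by simp
  qed
  then show ?thesis using o garc_subset_oarc[of A B] unit not_antipodal by blast
qed

lemma bd_in_closure: "quad_bd A B C D \<subseteq> closure X"
  using garc_in_closure quad.garc_in_closure[OF rotate] quad.garc_in_closure[OF quad.rotate[OF rotate]]
    quad.garc_in_closure[OF quad.rotate[OF quad.rotate[OF rotate]]]
  unfolding quad_bd_def by blast

end

context tiled_wheel
begin

text \<open>A common point would lie in \<open>K d\<close> and \<open>K 0\<close>, hence on the
  boundary of tile \<open>d\<close>, which its open region avoids.\<close>

lemma tiles_avoid_bd:
  assumes "d \<in> {1, 2}"
  shows "H d ` X \<inter> quad_bd (pole 0) (w (0 - 1)) (w 0) (w (0 + 1)) = {}"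
proof -
  have "K d \<inter> K 0 \<subseteq> quad_bd (pole d) (w (d - 1)) (w d) (w (d + 1))"
    using overlap[of "- d" d] assms by auto
  moreover have "quad_bd (pole 0) (w (0 - 1)) (w 0) (w (0 + 1)) \<subseteq> K 0"
    using quad.bd_in_closure[OF tile_quad[of 0]] unfolding tile_closure .
  moreover have "H d ` X \<subseteq> K d" using closure_subset[of "H d ` X"] unfolding tile_closure .
  ultimately show ?thesis using quad.disjoint_bd[OF tile_quad[of d]] by blast
qed

text \<open>The exchanging isometry reverses the boundary, so it carries \<open>X\<close> to the
  side \<open>- (e * s)\<close>. A reflection therefore preserves \<open>X\<close>. A rotation would
  move it to the complementary region, and tiles 1 and 2 would both fill the complement of tile
  0.\<close>

lemma symmetric_tile:
  assumes "c = k" "A \<bullet> C = B \<bullet> D"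
  obtains h where "orthogonal_transformation h" "h ` closure X = closure X" "h A = D" "h B = C" "h C = B" "h D = A"
proof -
  obtain h e where h: "orthogonal_map h e" "h A = D" "h B = C" "h C = B" "h D = A"
    using exchanging_symmetry[of A B C D] unit distinct lengths assms by auto
  interpret h: orthogonal_map h e by fact
  have q: "quad A B C D (h ` X)"
    using quad_reverse[OF h.quad[OF quad_axioms]] h by simp
  have cl: "orthogonal_transformation f \<Longrightarrow> closure (f ` S) = f ` closure S" for f :: "real^3 \<Rightarrow> real^3" and S
    by (intro closure_injective_linear_image[symmetric] orthogonal_transformation_linear orthogonal_transformation_inj)
  have "side (e * s) (h ` X) D C" using h.side[of s X A B] s h by simp
  then have "side (- (e * s)) (h ` X) C D" by (simp add: side_reverse)
  then have hX: "side (- (e * s)) (h ` X) A B"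
    using quad.side_cycle(2)[OF q, of "- (e * s)"] s h.e by auto
  show thesis
  proof (cases "e = 1")
    case False
    then have "side s (h ` X) A B" "s \<noteq> 0" using hX h.e s(1) by auto
    then have "h ` X = X" using same_side_eq[OF q _ s(2)] by blast
    then show thesis using that[OF h.orth] cl[OF h.orth, of X] h by simp
  next
    case True
    have cover: "Z = X \<or> Z = h ` X" if "Z \<in> components (sphere 0 1 - quad_bd A B C D)" for Z
    proof -
      have Z: "quad A B C D Z"
        using that unit not_antipodal distinct adjacent opposite by unfold_locales
      have "side s Z A B \<or> side (- s) Z A B" using quad.some_side[OF Z] s by auto
      moreover have "s \<noteq> 0" "- s \<noteq> 0" using s(1) by auto
      moreover have "side (- s) (h ` X) A B" using hX True by simp
      ultimately show ?thesis
        using same_side_eq[OF Z \<open>s \<noteq> 0\<close> s(2)] quad.same_side_eq[OF q Z \<open>- s \<noteq> 0\<close>] by blast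
    qed
    have union: "sphere 0 1 - quad_bd A B C D \<subseteq> X \<union> h ` X"
      using cover Union_components[of "sphere 0 1 - quad_bd A B C D"] by blast
    define W where "W = H 0 ` h ` X"
    obtain e0 where "orthogonal_map (H 0) e0" using orthogonal_map_exists[OF HT(1)] by metis
    then have bd0: "H 0 ` quad_bd A B C D = quad_bd (H 0 A) (H 0 B) (H 0 C) (H 0 D)"
      using orthogonal_map.quad_bd by metis
    have "quad_bd (H 0 A) (H 0 B) (H 0 C) (H 0 D) = quad_bd (pole 0) (w (0 - 1)) (w 0) (w (0 + 1))"
      using HT(3)[of 0] garc_commute unfolding quad_bd_def
      by (cases "T 0") (auto simp: partner_def other_def)
    note bd0 = bd0[unfolded this]
    have eq: "K d = closure W" if d: "d \<in> {1, 2}" for d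
    proof -
      have "H d ` X \<subseteq> W"
      proof
        fix x assume x: "x \<in> H d ` X"
        obtain x' where x': "x = H 0 x'" using orthogonal_transformation_surj[OF HT(1)] by (metis surjD)
        have "norm x = 1" using quad.subset_sphere[OF tile_quad[of d]] x by auto
        then have "norm x' = 1" using x' orthogonal_transformation_norm[OF HT(1)] by metis
        moreover have "x' \<notin> quad_bd A B C D"
          using tiles_avoid_bd[OF d] x x' bd0 by blast
        ultimately have "x' \<in> X \<union> h ` X" using union by auto
        moreover have "x' \<notin> X" using tiles_disjoint[of d 0] d x x' by auto
        ultimately show "x \<in> W" using x' by (auto simp: W_def)
      qed
      then have sub: "K d \<subseteq> closure W" using closure_mono tile_closure by metis
      \<comment> \<open>\<open>g\<close> carries the region complementary to tile 0 isometrically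
        onto tile \<open>d\<close>, which is contained in its closure; by compactness the two
        closures agree.\<close>
      define g where "g = H d \<circ> inv h \<circ> inv (H 0)"
      have o: "orthogonal_transformation g"
        unfolding g_def by (intro orthogonal_transformation_compose orthogonal_transformation_inv HT(1) h.orth)
      have "inv (H 0) ` H 0 ` S = S" "inv h ` h ` S = S" for S
        using orthogonal_transformation_inj[OF HT(1)] orthogonal_transformation_inj[OF h.orth] by simp_all
      then have "g ` W = H d ` X" unfolding g_def W_def image_comp[symmetric] by simp
      then have g: "g ` closure W = K d" using cl[OF o, of W] tile_closure by metis
      have "bounded W"
        unfolding W_def using quad.subset_sphere[OF q] orthogonal_transformation_norm[OF HT(1)]
        by (intro boundedI[of _ 1]) auto
      then have "g ` closure W = closure W"
        using sub g o by (intro isometric_self_map_surj)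
          (auto simp: orthogonal_transformation_isometry)
      then show ?thesis using g by simp
    qed
    have "K 1 = K 2" using eq[of 1] eq[of 2] by simp
    then have "K 1 \<subseteq> quad_bd (pole 1) (w (1 - 1)) (w 1) (w (1 + 1))" using overlap[of 1 1] by simp
    moreover have "H 1 ` X \<subseteq> K 1" using closure_subset[of "H 1 ` X"] unfolding tile_closure .
    ultimately have False
      using quad.disjoint_bd[OF tile_quad[of 1]] nonempty by blast
    then show thesis ..
  qed
qed

text \<open>If \<open>c = k\<close> and the diagonals differ, all types agree, and type
  \<open>T\<close> is absorbed by reversing the labels. Otherwise a tile of type \<open>T\<close>
  forces a symmetric prototile, and composing with the symmetry changes its type.\<close>

theorem wheel_chart:
  obtains A' B' C' D' where "(A', B', C', D') = (A, B, C, D) \<or> c = k \<and> (A', B', C', D') = (D, C, B, A)"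
    "\<And>j. \<exists>h. orthogonal_transformation h \<and> h ` closure X = K j \<and>
       [h B', h A', h D', h C'] = [pole j, w (partner j), w j, w (other j)]"
proof (cases "c = k \<and> A \<bullet> C \<noteq> B \<bullet> D")
  case True
  show thesis
  proof (cases "T 0")
    case T0: True
    show thesis
    proof (rule that[of D C B A])
      fix j
      have "T j" using type_constant[of j 0] T0 True by simp
      then show "\<exists>h. orthogonal_transformation h \<and> h ` closure X = K j \<and>
          [h C, h D, h A, h B] = [pole j, w (partner j), w j, w (other j)]"
        using HT[of j] by (intro exI[of _ "H j"]) simp
    qed (use True in simp)
  next
    case F: False
    show thesis
    proof (rule that[of A B C D])
      fix j
      have "\<not> T j" using type_constant[of j 0] F True by simp
      then show "\<exists>h. orthogonal_transformation h \<and> h ` closure X = K j \<and>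
          [h B, h A, h D, h C] = [pole j, w (partner j), w j, w (other j)]"
        using HT[of j] by (intro exI[of _ "H j"]) simp
    qed simp
  qed
next
  case False
  show thesis
  proof (rule that[of A B C D])
    fix j
    show "\<exists>h. orthogonal_transformation h \<and> h ` closure X = K j \<and>
        [h B, h A, h D, h C] = [pole j, w (partner j), w j, w (other j)]"
    proof (cases "T j")
      case False
      then show ?thesis using HT[of j] by (intro exI[of _ "H j"]) simp
    next
      case True
      then have "c = k" "A \<bullet> C = B \<bullet> D" using False type_of_distinct_lengths by auto
      then obtain h where h: "orthogonal_transformation h" "h ` closure X = closure X" "h A = D" "h B = C" "h C = B" "h D = A"
        using symmetric_tile by metis
      have "(H j \<circ> h) ` closure X = K j"
        unfolding image_comp[symmetric] h(2) by (rule HT(2))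
      then show ?thesis
        using HT(3)[of j] True h orthogonal_transformation_compose[OF HT(1)[of j] h(1)]
        by (intro exI[of _ "H j \<circ> h"]) simp
    qed
  qed simp
qed

end

section \<open>The pseudo-double wheel\<close>

definition idx :: "nat \<Rightarrow> int \<Rightarrow> nat" where
  "idx F j = nat (j mod int F)"

definition pole_vertex :: "int \<Rightarrow> pv" where
  "pole_vertex j = (if even j then Sv else Nv)"

definition face :: "nat \<Rightarrow> int \<Rightarrow> pv list" where
  "face F j = [pole_vertex j, Vv (idx F (j - 1)), Vv (idx F j), Vv (idx F (j + 1))]"

text \<open>For \<open>r = -1\<close> this is the reflection of the wheel fixing both poles and
  \<open>Vv 0\<close>, which supplies the mirror image of the chart.\<close>

definition cycle_map :: "nat \<Rightarrow> int \<Rightarrow> pv \<Rightarrow> pv" where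
  "cycle_map F r v = (case v of Vv i \<Rightarrow> Vv (idx F (r * int i)) | _ \<Rightarrow> v)"

lemma cycle_map_simps [simp]:
  "cycle_map F r Nv = Nv" "cycle_map F r Sv = Sv" "cycle_map F r (pole_vertex j) = pole_vertex j"
  by (simp_all add: cycle_map_def pole_vertex_def)

context
  fixes F m :: nat
  assumes F: "F = 2 * m" "m \<ge> 3"
begin

lemma idx_less: "idx F j < F"
  using F by (simp add: idx_def nat_less_iff)

lemma idx_eq_iff: "idx F i = idx F j \<longleftrightarrow> i mod int F = j mod int F"
  using F by (simp add: idx_def nat_eq_iff)

lemma idx_of_nat: "i < F \<Longrightarrow> idx F (int i) = i"
  by (simp add: idx_def)

lemma idx_mod: "idx F (int (i mod F)) = idx F (int i)"
  by (simp add: idx_eq_iff zmod_int)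

lemma even_idx: "even (idx F j) \<longleftrightarrow> even j"
proof -
  have "even (j mod int F) \<longleftrightarrow> even j" using F by (simp add: dvd_mod_iff)
  moreover have "int (idx F j) = j mod int F" using F by (simp add: idx_def)
  ultimately show ?thesis by (metis even_of_nat)
qed

lemma idx_idx: "idx F (r * int (idx F j)) = idx F (r * j)"
  using F by (simp add: idx_eq_iff) (simp add: idx_def mod_mult_right_eq)

lemma cycle_map_idx: "cycle_map F r (Vv (idx F j)) = Vv (idx F (r * j))"
  by (simp add: cycle_map_def idx_idx)

lemma NF_face: "i < m \<Longrightarrow> NF F i = face F (2 * int i + 1)"
  using F idx_of_nat[of "2 * i"] idx_of_nat[of "2 * i + 1"] idx_mod[of "2 * i + 2"] idx_of_nat[of "(2 * i + 2) mod F"]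
  by (simp add: NF_def face_def pole_vertex_def add.commute)

lemma SF_face: "i < m \<Longrightarrow> SF F i = face F (2 * int i)"
proof -
  assume i: "i < m"
  have "int (2 * i + F - 1) mod int F = (2 * int i - 1) mod int F"
  proof -
    have "int (2 * i + F - 1) = (2 * int i - 1) + int F" using F by simp
    then show ?thesis by (simp only: mod_add_self2)
  qed
  then have "(2 * i + F - 1) mod F = idx F (2 * int i - 1)"
    unfolding idx_def by (metis nat_int zmod_int)
  then show ?thesis
    using F i idx_of_nat[of "2 * i"] idx_of_nat[of "2 * i + 1"]
    by (simp add: SF_def face_def pole_vertex_def add.commute)
qed

lemma face_mod: "i mod int F = j mod int F \<Longrightarrow> face F i = face F j"
proof -
  assume ij: "i mod int F = j mod int F"
  then have "idx F i = idx F j" by (simp add: idx_eq_iff)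
  then have "even i \<longleftrightarrow> even j" using even_idx by metis
  moreover have "(i + d) mod int F = (j + d) mod int F" for d using ij by (metis mod_add_left_eq)
  from this[of 1] this[of "-1"] have "idx F (i + 1) = idx F (j + 1)" "idx F (i - 1) = idx F (j - 1)"
    by (simp_all add: idx_eq_iff)
  ultimately show ?thesis using \<open>idx F i = idx F j\<close> by (simp add: face_def pole_vertex_def)
qed

lemma pdw_faces_eq: "pdw_faces F = range (face F)"
proof
  show "pdw_faces F \<subseteq> range (face F)"
  proof
    fix f assume "f \<in> pdw_faces F"
    then obtain i where "i < m" "f = NF F i \<or> f = SF F i" using F(1) by (auto simp: pdw_faces_def)
    then show "f \<in> range (face F)" using NF_face SF_face by blast
  qed
  show "range (face F) \<subseteq> pdw_faces F"
  proof clarify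
    fix j
    define i where "i = nat ((j div 2) mod int m)"
    have i: "i < m" "int i = (j div 2) mod int m" using F by (simp_all add: i_def nat_less_iff)
    show "face F j \<in> pdw_faces F"
    proof (cases "even j")
      case True
      then have "(2 * int i) mod int F = j mod int F" using F i by (simp add: mult_mod_right)
      then have "face F j = SF F i" using face_mod SF_face[OF i(1)] by metis
      then show ?thesis using i F by (simp add: pdw_faces_def)
    next
      case False
      then have "j = 1 + 2 * (j div 2)" by presburger
      then have "j mod int F = 1 + 2 * ((j div 2) mod int m)"
        using F pos_zmod_mult_2[of "int m" "j div 2"] by simp
      also have "\<dots> = (2 * int i + 1) mod int F"
        using F i by simp
      finally have "face F j = NF F i" using face_mod NF_face[OF i(1)] by metis
      then show ?thesis using i F by (simp add: pdw_faces_def)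
    qed
  qed
qed

text \<open>The pole reveals the parity of the index, and only the middle one of the three cycle
  vertices has this parity.\<close>

lemma face_eq_if_set_eq:
  assumes "set (face F i) = set (face F j)"
  shows "face F i = face F j"
proof (rule face_mod)
  have "pole_vertex i = pole_vertex j"
    using assms by (auto simp: face_def pole_vertex_def split: if_splits)
  then have p: "even i \<longleftrightarrow> even j" by (simp add: pole_vertex_def split: if_splits)
  have "Vv (idx F i) \<in> set (face F j)" using assms[symmetric] by (simp add: face_def)
  then have "idx F i \<in> {idx F (j - 1), idx F j, idx F (j + 1)}"
    by (auto simp: face_def pole_vertex_def split: if_splits)
  then have "idx F i = idx F j"
    using p even_idx[of i] even_idx[of "j - 1"] even_idx[of "j + 1"] by auto
  then show "i mod int F = j mod int F" by (simp add: idx_eq_iff)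
qed

lemma face_neq:
  assumes "d \<in> {1, 2, -1, -2}"
  shows "face F i \<noteq> face F (i + d)"
proof
  assume "face F i = face F (i + d)"
  then have "(i + d) mod int F = i mod int F" by (simp add: face_def idx_eq_iff)
  then have "int F dvd d" by (metis add_diff_cancel_left' mod_eq_dvd_iff)
  then have "int F \<le> \<bar>d\<bar>" using assms by (intro zdvd_imp_le) auto
  then show False using assms F by auto
qed

lemma map_cycle_map_face:
  assumes "r = 1 \<or> r = -1"
  shows "set (map (cycle_map F r) (face F j)) = set (face F (r * j))"
    "dihedral_eq (face F (r * j)) (map (cycle_map F r) (face F j))"
proof -
  have m: "map (cycle_map F r) (face F j) =
      [pole_vertex j, Vv (idx F (r * (j - 1))), Vv (idx F (r * j)), Vv (idx F (r * (j + 1)))]"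
    by (simp add: face_def cycle_map_idx)
  have p: "pole_vertex (- j) = pole_vertex j" by (simp add: pole_vertex_def)
  show "set (map (cycle_map F r) (face F j)) = set (face F (r * j))"
    using assms unfolding m by (auto simp: face_def p)
  have "r * (j - 1) = r * j - r" "r * (j + 1) = r * j + r" by (simp_all add: algebra_simps)
  then show "dihedral_eq (face F (r * j)) (map (cycle_map F r) (face F j))"
    using assms unfolding m face_def dihedral_eq_4 by (elim disjE) (simp_all add: p cycle_map_idx)
qed

lemma bij_cycle_map:
  assumes "r = 1 \<or> r = -1"
  shows "bij_betw (cycle_map F r) (pdw_verts F) (pdw_verts F)"
proof -
  have "cycle_map F r (cycle_map F r v) = v" if "v \<in> pdw_verts F" for v
  proof (cases v)
    case (Vv i)
    then have "i < F" using that by (auto simp: pdw_verts_def)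
    then have "v = Vv (idx F (int i))" using Vv idx_of_nat by simp
    moreover have "r * (r * int i) = int i" using assms by auto
    ultimately show ?thesis by (simp only: cycle_map_idx)
  qed simp_all
  moreover have "cycle_map F r v \<in> pdw_verts F" if "v \<in> pdw_verts F" for v
    using that idx_less by (cases v) (auto simp: pdw_verts_def cycle_map_def)
  ultimately show ?thesis by (intro bij_betw_byWitness[where f' = "cycle_map F r"]) auto
qed

text \<open>Neighbours on the cycle have opposite parity; odd indices belong to N, which is joined
  to the even vertices, and even indices to S.\<close>

lemma meridian_idx: "{pole_vertex j, Vv (idx F (j - 1))} \<in> pdw_meridian F"
  "{pole_vertex j, Vv (idx F (j + 1))} \<in> pdw_meridian F"
proof -
  have "{pole_vertex j, Vv (idx F i)} \<in> pdw_meridian F" if "even i \<noteq> even j" for i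
  proof (cases "even j")
    case True
    then have "odd (idx F i)" using that even_idx by auto
    then obtain t where "idx F i = 2 * t + 1" by (elim oddE)
    moreover from this have "t < F div 2" using idx_less[of i] F by simp
    ultimately show ?thesis using True by (auto simp: pdw_meridian_def pole_vertex_def)
  next
    case False
    then have "even (idx F i)" using that even_idx by auto
    then obtain t where "idx F i = 2 * t" by (elim evenE)
    moreover from this have "t < F div 2" using idx_less[of i] F by simp
    ultimately show ?thesis using False by (auto simp: pdw_meridian_def pole_vertex_def)
  qed
  then show "{pole_vertex j, Vv (idx F (j - 1))} \<in> pdw_meridian F"
    "{pole_vertex j, Vv (idx F (j + 1))} \<in> pdw_meridian F" by simp_all
qed

end

lemma sdist_eq_iff:
  assumes "norm p = 1" "norm q = 1"
  shows "sdist p q = x \<longleftrightarrow> p \<bullet> q = cos x \<and> 0 \<le> x \<and> x \<le> pi"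
proof -
  have "\<bar>p \<bullet> q\<bar> \<le> 1" using Cauchy_Schwarz_ineq2[of p q] assms by simp
  then show ?thesis unfolding sdist_def
    by (metis abs_le_iff arccos arccos_cos minus_le_iff)
qed

theorem theorem5:
  fixes F t :: nat and pos :: "pv \<Rightarrow> real^3" and tile :: "pv list \<Rightarrow> (real^3) set"
    and Q :: "(real^3) set" and A B C D :: "real^3" and a b c :: real
  assumes "even F" and "F \<ge> 6"
    and "t \<in> {2, 4}"
    and "proto_type t Q A B C D a b c"
    and "pdw_tiling F pos tile"
    and "congruent_tiling F pos tile Q [A, B, C, D]"
    and "\<forall>u v. {u, v} \<in> pdw_meridian F \<longrightarrow> sdist (pos u) (pos v) \<noteq> b"
  shows "\<exists>\<psi>. bij_betw \<psi> (pdw_verts F) (pdw_verts F) \<and>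
            (\<forall>f \<in> pdw_faces F. \<exists>g \<in> pdw_faces F. dihedral_eq g (map \<psi> f)) \<and>
            (\<exists>A' B' C' D'. ((A', B', C', D') = (A, B, C, D) \<or>
                            (t = 2 \<and> (A', B', C', D') = (D, C, B, A))) \<and>
               chart_is_PF F pos tile \<psi> Q A' B' C' D' a b c)"
proof -
  obtain m where F: "F = 2 * m" "m \<ge> 3" using assms(1,2) by auto
  note faces = pdw_faces_eq[OF F]
  obtain X where X: "quad A B C D X" "Q = closure X"
    using sph_quadrangle_quad assms(4) unfolding proto_type_def by metis
  interpret quad A B C D X by (rule X)
  have len: "A \<bullet> B = cos a" "B \<bullet> C = cos a" "C \<bullet> D = cos c" "D \<bullet> A = cos b"
    and rng: "0 \<le> a" "a \<le> pi" "0 \<le> b" "b \<le> pi" "0 \<le> c" "c \<le> pi"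
    using assms(4) unit unfolding proto_type_def by (simp_all add: sdist_eq_iff)
  have "a \<noteq> b" "b \<noteq> c" and t: "a = c \<longrightarrow> t = 2" using assms(4) by (auto simp: proto_type_def)
  then have neq: "cos b \<noteq> cos a" "cos b \<noteq> cos c" and eq: "cos c = cos a \<Longrightarrow> c = a"
    using rng by (metis cos_inj_pi)+
  \<comment> \<open>Both numberings, \<open>r = 1\<close> and the reflected \<open>r = -1\<close>,
    are prepared; the position of the \<open>b\<close>-edges decides between them later.\<close>
  define u where "u r j = pos (Vv (idx F (r * j)))" for r j
  define n where "n j = pos (pole_vertex j)" for j
  define K where "K r j = tile (face F (r * j))" for r j
  have vert: "norm (pos v) = 1" if "v \<in> pdw_verts F" for v
    using assms(5) that by (auto simp: pdw_tiling_def)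
  have unit_u: "norm (u r j) = 1" "norm (n j) = 1" for r j
    using idx_less[OF F] by (auto simp: u_def n_def pole_vertex_def pdw_verts_def intro!: vert)
  have list: "map pos (face F (r * j)) =
      (if r = 1 then [n j, u r (j - 1), u r j, u r (j + 1)] else [n j, u r (j + 1), u r j, u r (j - 1)])"
    if "r = 1 \<or> r = -1" for r j
    using that by (auto simp: face_def u_def n_def pole_vertex_def)
  have bd: "qbd (map pos (face F (r * j))) = quad_bd (n j) (u r (j - 1)) (u r j) (u r (j + 1))"
    if "r = 1 \<or> r = -1" for r j
    unfolding list[OF that] using that garc_commute by (auto simp: qbd_quad quad_bd_def)
  have wheel: "wheel A B C D X (u r) n (K r) (cos a) (cos c) (cos b)" if r: "r = 1 \<or> r = -1" for r
  proof
    fix j d :: int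
    show "n (j + 2) = n j" by (simp add: n_def pole_vertex_def)
    show "K r j \<inter> K r (j + d) \<subseteq> quad_bd (n j) (u r (j - 1)) (u r j) (u r (j + 1))"
      if "d \<in> {1, 2, -1, -2}"
    proof -
      have "r * d \<in> {1, 2, -1, -2}" using r that by auto
      then have "face F (r * j) \<noteq> face F (r * (j + d))"
        using face_neq[OF F, of "r * d" "r * j"] by (simp add: distrib_left)
      then show ?thesis
        using assms(5) unfolding pdw_tiling_def faces K_def bd[OF r, symmetric] by blast
    qed
    show "\<exists>h. orthogonal_transformation h \<and> h ` closure X = K r j \<and>
        dihedral_eq [n j, u r (j - 1), u r j, u r (j + 1)] [h A, h B, h C, h D]"
    proof -
      obtain h where h: "orthogonal_transformation h" "h ` Q = tile (face F (r * j))"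
        "dihedral_eq (map pos (face F (r * j))) (map h [A, B, C, D])"
        using assms(6) unfolding congruent_tiling_def faces by blast
      have "dihedral_eq [n j, u r (j - 1), u r j, u r (j + 1)] [h A, h B, h C, h D]"
        using h(3) unfolding list[OF r] by (auto simp: dihedral_eq_4 split: if_splits)
      then show ?thesis using h X by (auto simp: K_def)
    qed
    have mer: "n j \<bullet> pos v \<noteq> cos b" if "{pole_vertex j, v} \<in> pdw_meridian F" "norm (pos v) = 1" for v
      using assms(7) that sdist_eq_iff[OF unit_u(2)[of j] that(2), of b] rng by (auto simp: n_def)
    \<comment> \<open>Index \<open>j\<close> serves the numbering \<open>r = 1\<close>, index
      \<open>- j\<close> the reflected one.\<close>
    have "n j \<bullet> u 1 (i - 1) \<noteq> cos b" "n j \<bullet> u 1 (i + 1) \<noteq> cos b" if "even i \<longleftrightarrow> even j" for i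
      using meridian_idx[OF F, of i] mer unit_u(1)[of 1] that by (auto simp: u_def pole_vertex_def)
    from this[of j] this[of "- j"] show "n j \<bullet> u r (j - 1) \<noteq> cos b" "n j \<bullet> u r (j + 1) \<noteq> cos b"
      using r by (auto simp: u_def diff_minus_eq_add)
  qed (use len neq in auto)
  obtain r where r: "r = 1 \<or> r = -1" "u r 0 \<bullet> u r 1 = cos b"
  proof (cases "u 1 0 \<bullet> u 1 1 = cos b")
    case False
    \<comment> \<open>The \<open>b\<close>-edge at \<open>Vv 0\<close> then precedes it on the
      cycle, and the reflected numbering places it at indices 0 and 1.\<close>
    then have "u 1 (-1) \<bullet> u 1 0 = cos b"
      using wheel.edge_alternates[OF wheel, of 1 0] by simp
    then show ?thesis by (intro that[of "-1"]) (simp_all add: u_def inner_commute)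
  qed (use that in blast)
  interpret tiled_wheel A B C D X "u r" n "K r" "cos a" "cos c" "cos b"
    using wheel[OF r(1)] r(2) by (simp add: tiled_wheel_def tiled_wheel_axioms_def)
  obtain A' B' C' D' where ABCD': "(A', B', C', D') = (A, B, C, D) \<or> cos c = cos a \<and> (A', B', C', D') = (D, C, B, A)"
    and ex: "\<And>j. \<exists>h. orthogonal_transformation h \<and> h ` closure X = K r j \<and>
       [h B', h A', h D', h C'] = [n j, u r (partner j), u r j, u r (other j)]"
    by (rule wheel_chart) (rule that, assumption+)
  then have h: "\<exists>h. orthogonal_transformation h \<and> h ` Q = tile (face F (r * j)) \<and>
       h B' = n j \<and> h A' = u r (partner j) \<and> h D' = u r j \<and> h C' = u r (other j)" for j
    using X(2) ex[of j] by (auto simp: K_def)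
  have len': "A' \<bullet> B' = cos a" "D' \<bullet> C' = cos c" "A' \<bullet> D' = cos b"
    using ABCD' len by (auto simp: inner_commute)
  have dist: "n j \<bullet> u r (partner j) = cos a" "u r j \<bullet> u r (other j) = cos c" "u r j \<bullet> u r (partner j) = cos b" for j
    using h[of j] len' orthogonal_inner by (metis inner_commute)+
  let ?\<psi> = "cycle_map F r"
  have \<psi>: "pos (?\<psi> (Vv (idx F j))) = u r j" "pos (?\<psi> (pole_vertex j)) = n j" for j
    by (simp_all add: cycle_map_idx[OF F] u_def n_def)
  \<comment> \<open>The chart refers to a face by its vertex set, which determines the face.\<close>
  have tile_eq: "tile g = tile (face F (r * j))" if "g \<in> pdw_faces F" "set g = ?\<psi> ` set (face F j)" for g j
  proof -
    obtain i where "g = face F i" using \<open>g \<in> pdw_faces F\<close> faces by auto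
    then have "g = face F (r * j)"
      using that(2) map_cycle_map_face(1)[OF F r(1), of j] face_eq_if_set_eq[OF F, of i "r * j"] by simp
    then show ?thesis by simp
  qed
  have map: "map (pos \<circ> ?\<psi>) (face F j) = [n j, u r (j - 1), u r j, u r (j + 1)]" for j
    using \<psi> by (simp add: face_def)
  have half: "F div 2 = m" using F by simp
  have "chart_is_PF F pos tile ?\<psi> Q A' B' C' D' a b c"
    unfolding chart_is_PF_def half
  proof (intro conjI allI impI ballI)
    fix i g assume i: "i < m" and g: "g \<in> pdw_faces F" "set g = ?\<psi> ` set (NF F i)"
    then have "tile g = tile (face F (r * (2 * int i + 1)))"
      using tile_eq NF_face[OF F i] by simp
    then show "\<exists>h. orthogonal_transformation h \<and> h ` Q = tile g \<and>
        map h [B', A', D', C'] = map (pos \<circ> ?\<psi>) (NF F i)"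
      unfolding NF_face[OF F i] map using h[of "2 * int i + 1"] by (auto simp: partner_def other_def)
  next
    fix i g assume i: "i < m" and g: "g \<in> pdw_faces F" "set g = ?\<psi> ` set (SF F i)"
    then have "tile g = tile (face F (r * (2 * int i)))"
      using tile_eq SF_face[OF F i] by simp
    then show "\<exists>h. orthogonal_transformation h \<and> h ` Q = tile g \<and>
        map h [B', C', D', A'] = map (pos \<circ> ?\<psi>) (SF F i)"
      unfolding SF_face[OF F i] map using h[of "2 * int i"] by (auto simp: partner_def other_def)
  next
    fix j assume j: "j < F"
    have v: "Vv (idx F (int j)) = Vv j" "Vv (idx F (int j + 1)) = Vv ((j + 1) mod F)"
      using idx_of_nat[OF F j] idx_mod[OF F, of "j + 1"] idx_of_nat[OF F, of "(j + 1) mod F"] F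
      by (simp_all add: add.commute)
    have "pos (?\<psi> (Vv j)) = u r (int j)" "pos (?\<psi> (Vv ((j + 1) mod F))) = u r (int j + 1)"
      using \<psi>(1)[of "int j"] \<psi>(1)[of "int j + 1"] unfolding v .
    then show "sdist (pos (?\<psi> (Vv j))) (pos (?\<psi> (Vv ((j + 1) mod F)))) = (if even j then b else c)"
      using dist[of "int j"] rng unit_u by (cases "even j") (simp_all add: sdist_eq_iff partner_def other_def)
  next
    fix i assume i: "i < m"
    have "Vv (2 * i) = Vv (idx F (2 * int i))" "Nv = pole_vertex (2 * int i + 1)"
      using idx_of_nat[OF F, of "2 * i"] F i by (simp_all add: pole_vertex_def)
    then have "pos (?\<psi> Nv) = n (2 * int i + 1)" "pos (?\<psi> (Vv (2 * i))) = u r (2 * int i)"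
      using \<psi> by metis+
    then show "sdist (pos (?\<psi> Nv)) (pos (?\<psi> (Vv (2 * i)))) = a"
      using dist[of "2 * int i + 1"] rng unit_u by (simp add: sdist_eq_iff partner_def)
  next
    fix i assume i: "i < m"
    have "Vv (2 * i + 1) = Vv (idx F (2 * int i + 1))" "Sv = pole_vertex (2 * int i)"
      using idx_of_nat[OF F, of "2 * i + 1"] F i by (simp_all add: pole_vertex_def add.commute)
    then have "pos (?\<psi> Sv) = n (2 * int i)" "pos (?\<psi> (Vv (2 * i + 1))) = u r (2 * int i + 1)"
      using \<psi> by metis+
    then show "sdist (pos (?\<psi> Sv)) (pos (?\<psi> (Vv (2 * i + 1)))) = a"
      using dist[of "2 * int i"] rng unit_u by (simp add: sdist_eq_iff partner_def)
  qed
  \<comment> \<open>Labels are reversed only if \<open>cos c = cos a\<close>, which on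
    \<open>[0, pi]\<close> means \<open>c = a\<close>, that is type 2.\<close>
  moreover have "(A', B', C', D') = (A, B, C, D) \<or> t = 2 \<and> (A', B', C', D') = (D, C, B, A)"
    using ABCD' eq t by auto
  moreover have "\<forall>f \<in> pdw_faces F. \<exists>g \<in> pdw_faces F. dihedral_eq g (map ?\<psi> f)"
    unfolding faces using map_cycle_map_face(2)[OF F r(1)] by blast
  ultimately show ?thesis using bij_cycle_map[OF F r(1)] by blast
qed

end
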